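(* Let $p=2$ and let $n\ge k\ge 1$ be integers. Let $M$ be the maximum pole of $B_{n-k}^{(n)}(x)$ and $M'$ the maximum pole of $B_{n-k}^{(n+1)}(x)$. (i) $s(n,k)$ is a minimum zero case (MZC) if and only if $2\nmid\binom{k-1}{n-k}$. (ii) $s(n,k)$ is a shifted minimum zero case (SMZC) if and only if $2\nmid\binom{k}{n-k}$, i.e., if and only if $s(n+1,k+1)$ is a MZC. (iii) $s(n,k)$ is an almost minimum zero case (AMZC) if and only if precisely one of the following holds: (a) $\nu_2\left(\binom{k-1}{n-k}\right)=\sigma_2(n-k)-M$; (b) $\nu_2\left(\binom{k-1}{n-k-1}\right)=\sigma_2(n-k)-M-1$; (c) $n-k$ is odd and $\nu_2\left(\binom{k-1}{n-k-2}\right)=\sigma_2(n-k)-M-1$. (iv) $s(n,k)$ is a shifted almost minimum zero case (SAMZC) if and only if precisely one of the following holds: (a) $\nu_2\left(\binom{k}{n-k}\right)=\sigma_2(n-k)-M'$; (b) $n-k$ is odd and $\nu_2\left(\binom{k}{n-k-2}\right)=\sigma_2(n-k)-M'-1$. Furthermore, if $\nu_2(n+1)\le\nu_2(k+1)$, then $s(n,k)$ is a SAMZC if and only if $s(n+1,k+1)$ is an AMZC, and if these cases hold, then $\nu_2(s(n,k))=\nu_2(s(n+1,k+1))$.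
   Context: $s(n,k)$ is the (unsigned) Stirling number of the first kind, defined by $x(x-1)\cdots(x-n+1)=\sum_{k=0}^n(-1)^{n-k}s(n,k)x^k$. $\sigma_2(m)$ is the sum of the base $2$ digits of $m\ge 0$; $\nu_2$ is the $2$-adic valuation, with $\nu_2(0)=\infty$. Binomial coefficients $\binom ab$ with $a\ge 0$ are $0$ if $b<0$ or $b>a$. Higher order Bernoulli polynomials $B_m^{(l)}(x)$ ($m\ge 0$, $l\in\mathbb Z$) are defined by $\left(\frac{t}{e^t-1}\right)^l e^{tx}=\sum_{m\ge 0}B_m^{(l)}(x)\frac{t^m}{m!}$; $B_m^{(l)}(x)$ is monic of degree $m$ with rational coefficients, and $B_m^{(l)}=B_m^{(l)}(0)$. The maximum pole (here with respect to $p=2$) of a nonzero rational polynomial is the integer $M$ such that $-M$ is the minimum of the $2$-adic valuations of its coefficients. One has $s(n,k)=\binom{n-1}{k-1}B_{n-k}^{(n)}=\binom nk B_{n-k}^{(n+1)}(1)$. With $M,M'$ the maximum poles of $B_{n-k}^{(n)}(x)$ and $B_{n-k}^{(n+1)}(x)$ respectively: $s(n,k)$ is a MZC if $\nu_2(s(n,k))=\sigma_2(k-1)-\sigma_2(n-1)$; a SMZC if $\nu_2(s(n,k))=\sigma_2(k)-\sigma_2(n)$; an AMZC if $\nu_2(s(n,k))=\nu_2\left(\binom{n-1}{k-1}\right)-M$; a SAMZC if $\nu_2(s(n,k))=\nu_2\left(\binom nk\right)-M'$. *)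

theory Defs
  imports
    "HOL-Computational_Algebra.Computational_Algebra"
    "HOL-Combinatorics.Stirling"
    "HOL-Library.Extended"
begin

(* The library's "stirling" is the unsigned Stirling number of the first kind,
   in the convention of the falling factorial. *)
lemma stirling_falling_factorial:
  fixes x :: "'a::comm_ring_1"
  shows "(\<Prod>i<n. x - of_nat i) = (\<Sum>k\<le>n. (-1) ^ (n - k) * of_nat (stirling n k) * x ^ k)"
proof -
  have "(\<Prod>i<n. x - of_nat i) = (\<Prod>i<n. (-1) * (- x + of_nat i))"
    by (rule prod.cong) auto
  also have "\<dots> = (-1) ^ n * pochhammer (- x) n"
    by (simp only: prod.distrib pochhammer_prod) (simp add: atLeast0LessThan)
  also have "\<dots> = (\<Sum>k\<le>n. (-1) ^ n * (of_nat (stirling n k) * (- x) ^ k))"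
    by (simp add: stirling_pochhammer [symmetric] sum_distrib_left)
  also have "\<dots> = (\<Sum>k\<le>n. (-1) ^ (n - k) * of_nat (stirling n k) * x ^ k)"
  proof (rule sum.cong)
    fix k assume "k \<in> {..n}"
    then have n: "n = (n - k) + k" by simp
    have "(-1) ^ n * (- x) ^ k = (-1) ^ (n - k) * ((-1) ^ k * (- x) ^ k)"
      by (subst n) (simp only: power_add mult.assoc)
    also have "(-1) ^ k * (- x) ^ k = x ^ k"
      by (simp add: power_mult_distrib [symmetric])
    finally show "(-1) ^ n * (of_nat (stirling n k) * (- x) ^ k)
        = (-1) ^ (n - k) * of_nat (stirling n k) * x ^ k"
      by (simp add: algebra_simps)
  qed simp
  finally show ?thesis .
qed

fun sigma2 :: "nat \<Rightarrow> nat" where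
  "sigma2 m = (if m = 0 then 0 else m mod 2 + sigma2 (m div 2))"

declare sigma2.simps [simp del]

definition nu2 :: "rat \<Rightarrow> int extended" where
  "nu2 x = (if x = 0 then \<infinity>
     else case quotient_of x of
       (a, b) \<Rightarrow> Fin (int (multiplicity 2 a) - int (multiplicity 2 b)))"

(* The lower index is an integer, because truncated subtraction would turn a
   negative lower index into 0 and the coefficient into 1. *)
definition binom :: "nat \<Rightarrow> int \<Rightarrow> nat" where
  "binom a b = (if b < 0 then 0 else a choose nat b)"

(* B_m^(l)(x). The product is taken in Q[x][[t]]: the first factor is
   (t / (e^t - 1))^l with constant-polynomial coefficients, the second is e^(t x). *)
definition higher_bernpoly :: "int \<Rightarrow> nat \<Rightarrow> rat poly" where
  "higher_bernpoly l m = smult (fact m) (fps_nth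
     (Abs_fps (\<lambda>i. [:fps_nth ((fps_X / (fps_exp 1 - 1)) powi l) i:])
      * Abs_fps (\<lambda>j. monom (1 / fact j) j)) m)"

(* Zero coefficients have valuation \<infinity> and do not affect the minimum. *)
definition max_pole :: "rat poly \<Rightarrow> int" where
  "max_pole q = (THE M. Fin (- M) = Min (nu2 ` set (coeffs q)))"

definition MZC :: "nat \<Rightarrow> nat \<Rightarrow> bool" where
  "MZC n k \<longleftrightarrow> nu2 (of_nat (stirling n k)) = Fin (int (sigma2 (k - 1)) - int (sigma2 (n - 1)))"

definition SMZC :: "nat \<Rightarrow> nat \<Rightarrow> bool" where
  "SMZC n k \<longleftrightarrow> nu2 (of_nat (stirling n k)) = Fin (int (sigma2 k) - int (sigma2 n))"

definition AMZC :: "nat \<Rightarrow> nat \<Rightarrow> bool" where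
  "AMZC n k \<longleftrightarrow> nu2 (of_nat (stirling n k)) =
     nu2 (of_nat ((n - 1) choose (k - 1))) - Fin (max_pole (higher_bernpoly (int n) (n - k)))"

definition SAMZC :: "nat \<Rightarrow> nat \<Rightarrow> bool" where
  "SAMZC n k \<longleftrightarrow> nu2 (of_nat (stirling n k)) =
     nu2 (of_nat (n choose k)) - Fin (max_pole (higher_bernpoly (int n + 1) (n - k)))"

definition exactly_one :: "bool list \<Rightarrow> bool" where
  "exactly_one Ps \<longleftrightarrow> (\<exists>!i. i < length Ps \<and> Ps ! i)"

end

(* Put g = log (1 + y) / y and n = k + d. Then s(n,k) is, up to sign, n!/k! [y^d] g^k, and also
   (n-1)!/(k-1)! [y^d] g^(k-1) / (1 + y). The substitution t = log (1 + y) turns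
   B_d^(K+d+1)(x) into the sum over r of d!/r! [y^(d-r)] g^K (x-1)(x-2)...(x-r), so the maximum pole is
   read off from the coefficients of g^K. After the scaling y -> 2y write g = 1 + y p; then
   [y^d] g^K is the sum over j of binom(K,j) [y^(d-j)] p^j, and the coefficient of y^r in p^j
   is congruent to that of (-1)^j (1 + 2 j y^2) modulo 2^(sigma2(r) + 1). As sigma2 is subadditive, the bound
   that the pole M puts on the coefficients of g^K is equivalent to the same bound on the binomial
   coefficients binom(K,j), and with mu = sigma2(d) - M one finds modulo 2^(mu + 1), up to sign,
     2^d [y^d] g^K = binom(K,d) + 2 d binom(K,d-2),
     2^d [y^d] g^K / (1 + y) = binom(K,d) + 2 binom(K,d-1) + 2 d binom(K,d-2),
   where every summand has valuation at least mu. The valuation is therefore exactly mu iff an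
   odd number of summands have valuation mu, and all three cannot have it simultaneously.
   The minimum zero cases are the instance mu = 0. *)

theory Submission
  imports Defs
begin

section \<open>2-adic valuation bounds and binary digit sums\<close>

text \<open>Encodes \<open>Fin m \<le> nu2 x\<close> by a fraction with odd denominator. The
  numerator may be even or zero, so sums and products keep this form without case
  distinctions.\<close>

definition nu2_ge :: "int \<Rightarrow> rat \<Rightarrow> bool" where
  "nu2_ge m x \<longleftrightarrow> (\<exists>a b :: int. odd b \<and> x = 2 powi m * (of_int a / of_int b))"

lemma nu2_geI: "odd b \<Longrightarrow> x = 2 powi m * (of_int a / of_int b) \<Longrightarrow> nu2_ge m x"
  unfolding nu2_ge_def by blast

lemma nu2_ge_0 [simp]: "nu2_ge m 0"
  by (rule nu2_geI [of 1 _ _ 0]) auto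

lemma odd_of_int_neq_0: "odd (b :: int) \<Longrightarrow> (of_int b :: rat) \<noteq> 0"
  by auto

lemma nu2_ge_mono:
  assumes "nu2_ge m x" and "l \<le> m"
  shows "nu2_ge l x"
proof -
  from assms(1) obtain a b :: int where ab: "odd b" "x = 2 powi m * (of_int a / of_int b)"
    unfolding nu2_ge_def by blast
  obtain e where m: "m = l + int e"
    using zle_iff_zadd assms(2) by blast
  have "x = 2 powi l * (of_int (2 ^ e * a) / of_int b)"
    unfolding ab(2) m by (simp add: power_int_add)
  with ab(1) show ?thesis by (rule nu2_geI)
qed

lemma nu2_ge_add:
  assumes "nu2_ge m x" and "nu2_ge m y"
  shows "nu2_ge m (x + y)"
proof -
  from assms obtain a b c d :: int where x: "odd b" "x = 2 powi m * (of_int a / of_int b)"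
    and y: "odd d" "y = 2 powi m * (of_int c / of_int d)"
    unfolding nu2_ge_def by blast
  have "x + y = 2 powi m * (of_int (a * d + c * b) / of_int (b * d))"
    unfolding x(2) y(2) using odd_of_int_neq_0 [OF x(1)] odd_of_int_neq_0 [OF y(1)]
    by (simp add: add_frac_eq flip: distrib_left times_divide_eq_right)
  moreover have "odd (b * d)" using x(1) y(1) by simp
  ultimately show ?thesis by (intro nu2_geI)
qed

lemma nu2_ge_mult:
  assumes "nu2_ge m x" and "nu2_ge l y"
  shows "nu2_ge (m + l) (x * y)"
proof -
  from assms obtain a b c d :: int where x: "odd b" "x = 2 powi m * (of_int a / of_int b)"
    and y: "odd d" "y = 2 powi l * (of_int c / of_int d)"
    unfolding nu2_ge_def by blast
  have "x * y = 2 powi (m + l) * (of_int (a * c) / of_int (b * d))"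
    unfolding x(2) y(2) by (simp add: power_int_add)
  moreover have "odd (b * d)" using x(1) y(1) by simp
  ultimately show ?thesis by (intro nu2_geI)
qed

lemma nu2_ge_of_int [simp]: "nu2_ge 0 (of_int a)"
  by (rule nu2_geI [of 1]) auto

lemma nu2_ge_of_nat [simp]: "nu2_ge 0 (of_nat a)"
  using nu2_ge_of_int [of "int a"] by simp

lemma nu2_ge_mult_of_int: "nu2_ge m x \<Longrightarrow> nu2_ge m (of_int a * x)"
  using nu2_ge_mult [of 0 "of_int a" m x] by simp

lemma nu2_ge_mult_of_nat: "nu2_ge m x \<Longrightarrow> nu2_ge m (of_nat a * x)"
  using nu2_ge_mult [of 0 "of_nat a" m x] by simp

lemma nu2_ge_minus_iff [simp]: "nu2_ge m (- x) \<longleftrightarrow> nu2_ge m x"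
  using nu2_ge_mult_of_int [of m x "-1"] nu2_ge_mult_of_int [of m "- x" "-1"] by auto

lemma nu2_ge_diff: "nu2_ge m x \<Longrightarrow> nu2_ge m y \<Longrightarrow> nu2_ge m (x - y)"
  using nu2_ge_add [of m x "- y"] by simp

lemma nu2_ge_sum: "(\<And>i. i \<in> A \<Longrightarrow> nu2_ge m (f i)) \<Longrightarrow> nu2_ge m (sum f A)"
  by (induction A rule: infinite_finite_induct) (auto intro: nu2_ge_add)

lemma nu2_ge_cong:
  assumes "nu2_ge m (x - y)"
  shows "nu2_ge m x \<longleftrightarrow> nu2_ge m y"
  using nu2_ge_add [of m "x - y" y] nu2_ge_diff [of m x "x - y"] assms by auto

lemma nu2_ge_minus_one_power_iff [simp]: "nu2_ge m ((- 1) ^ j * x) \<longleftrightarrow> nu2_ge m x"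
  by (cases "even j") auto

lemma nu2_ge_two_powi: "nu2_ge m (2 powi m)"
  by (rule nu2_geI [of 1 _ _ 1]) auto

lemma nu2_ge_two_powi_mult_iff: "nu2_ge (e + m) (2 powi e * x) \<longleftrightarrow> nu2_ge m x"
proof
  assume "nu2_ge (e + m) (2 powi e * x)"
  then have "nu2_ge (- e + (e + m)) (2 powi - e * (2 powi e * x))"
    by (rule nu2_ge_mult [OF nu2_ge_two_powi])
  moreover have "2 powi - e * (2 powi e * x) = x"
    by (simp add: power_int_minus)
  ultimately show "nu2_ge m x" by simp
qed (rule nu2_ge_mult [OF nu2_ge_two_powi])

lemma nu2_ge_two_mult_iff: "nu2_ge m (2 * x) \<longleftrightarrow> nu2_ge (m - 1) x"
  using nu2_ge_two_powi_mult_iff [of 1 "m - 1" x] by simp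

lemma nu2_ge_two_power: "nu2_ge (int m) (2 ^ m)"
  by (rule nu2_geI [of 1 _ _ 1]) auto

lemma nu2_ge_odd_mult_iff:
  assumes "odd (c :: int)"
  shows "nu2_ge m (of_int c * x) \<longleftrightarrow> nu2_ge m x"
proof
  assume "nu2_ge m (of_int c * x)"
  then obtain a b :: int where ab: "odd b" "of_int c * x = 2 powi m * (of_int a / of_int b)"
    unfolding nu2_ge_def by blast
  have "x = of_int c * x / of_int c" using odd_of_int_neq_0 [OF assms] by simp
  also have "\<dots> = 2 powi m * (of_int a / of_int (b * c))" unfolding ab(2) by simp
  finally have "x = 2 powi m * (of_int a / of_int (b * c))" .
  moreover have "odd (b * c)" using ab(1) assms by simp
  ultimately show "nu2_ge m x" by (intro nu2_geI)
qed (rule nu2_ge_mult_of_int)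

lemma nu2_ge_odd_rat_mult_iff:
  assumes "odd (c :: int)" and "odd (d :: int)"
  shows "nu2_ge m (of_int c / of_int d * x) \<longleftrightarrow> nu2_ge m x"
proof -
  have "nu2_ge m (of_int c / of_int d * x) \<longleftrightarrow> nu2_ge m (of_int c * (x / of_int d))" by simp
  also have "\<dots> \<longleftrightarrow> nu2_ge m (x / of_int d)" by (rule nu2_ge_odd_mult_iff) fact
  also have "\<dots> \<longleftrightarrow> nu2_ge m (of_int d * (x / of_int d))"
    by (rule nu2_ge_odd_mult_iff [symmetric]) fact
  also have "of_int d * (x / of_int d) = x"
    using odd_of_int_neq_0 [OF assms(2)] by simp
  finally show ?thesis .
qed

lemma nu2_ge_1_of_int_iff: "nu2_ge 1 (of_int a) \<longleftrightarrow> even a"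
proof
  assume "nu2_ge 1 (of_int a)"
  then obtain c b :: int where b: "odd b" and "of_int a = (2 :: rat) powi 1 * (of_int c / of_int b)"
    unfolding nu2_ge_def by blast
  then have "(of_int (a * b) :: rat) = of_int (2 * c)"
    using odd_of_int_neq_0 [OF b] by (simp add: field_simps)
  then have "a * b = 2 * c" by linarith
  with b show "even a" by (metis dvd_triv_left even_mult_iff)
next
  assume "even a"
  then obtain c where "a = 2 * c" by blast
  then show "nu2_ge 1 (of_int a)" by (intro nu2_geI [of 1 _ _ c]) auto
qed

lemma not_nu2_ge_1_odd_rat:
  assumes "odd (a :: int)" and "odd (b :: int)"
  shows "\<not> nu2_ge 1 (of_int a / of_int b)"
  using nu2_ge_odd_rat_mult_iff [OF assms, of 1 1] nu2_ge_1_of_int_iff [of 1] by auto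

section \<open>Exact valuations and their multiplicativity\<close>

lemma odd_part_int:
  assumes "(a :: int) \<noteq> 0"
  obtains c where "odd c" and "a = 2 ^ multiplicity 2 a * c"
proof -
  from assms obtain c where c: "a = 2 ^ multiplicity 2 a * c" "\<not> 2 dvd c"
    by (rule multiplicity_decompose'[where p=2]) auto
  then show ?thesis using that by blast
qed

lemma nu2_eq_Fin_obtain:
  assumes "x \<noteq> 0"
  obtains m and a b :: int
  where "odd a" and "odd b" and "x = 2 powi m * (of_int a / of_int b)" and "nu2 x = Fin m"
proof -
  obtain p q where pq: "quotient_of x = (p, q)" by (cases "quotient_of x")
  then have q: "q > 0" and x: "x = of_int p / of_int q"
    by (auto simp: quotient_of_denom_pos quotient_of_div)
  with assms have "p \<noteq> 0" by auto
  then obtain a where a: "odd a" "p = 2 ^ multiplicity 2 p * a" by (rule odd_part_int)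
  from q obtain b where b: "odd b" "q = 2 ^ multiplicity 2 q * b"
    using odd_part_int [of q] by auto
  define m where "m = int (multiplicity 2 p) - int (multiplicity 2 q)"
  have "x = of_int (2 ^ multiplicity 2 p * a) / of_int (2 ^ multiplicity 2 q * b)"
    using x a(2) b(2) by metis
  also have "\<dots> = 2 powi m * (of_int a / of_int b)"
    by (simp add: m_def power_int_diff)
  finally have "x = 2 powi m * (of_int a / of_int b)" .
  moreover have "nu2 x = Fin m"
    using assms pq by (simp add: nu2_def m_def)
  ultimately show ?thesis using that a(1) b(1) by blast
qed

lemma nu2_0 [simp]: "nu2 0 = \<infinity>"
  by (simp add: nu2_def)

lemma nu2_neq_Minf: "nu2 x \<noteq> Minf"
proof (cases "x = 0")
  case False
  then show ?thesis by (rule nu2_eq_Fin_obtain) simp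
qed simp

lemma nu2_ge_two_powi_odd_iff:
  assumes "odd (a :: int)" and "odd (b :: int)"
  shows "nu2_ge l (2 powi m * (of_int a / of_int b)) \<longleftrightarrow> l \<le> m"
proof
  assume *: "nu2_ge l (2 powi m * (of_int a / of_int b))"
  show "l \<le> m"
  proof (rule ccontr)
    assume "\<not> l \<le> m"
    with * have "nu2_ge (m + 1) (2 powi m * (of_int a / of_int b))"
      by (auto elim: nu2_ge_mono)
    then have "nu2_ge 1 (of_int a / of_int b)" by (simp only: nu2_ge_two_powi_mult_iff)
    with not_nu2_ge_1_odd_rat [OF assms] show False by blast
  qed
next
  assume "l \<le> m"
  moreover have "nu2_ge m (2 powi m * (of_int a / of_int b))"
    using assms(2) by (rule nu2_geI [of b _ _ a]) simp
  ultimately show "nu2_ge l (2 powi m * (of_int a / of_int b))" by (rule nu2_ge_mono[rotated])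
qed

lemma nu2_ge_iff: "nu2_ge m x \<longleftrightarrow> Fin m \<le> nu2 x"
proof (cases "x = 0")
  case False
  then obtain l and a b :: int
    where "odd a" "odd b" "x = 2 powi l * (of_int a / of_int b)" "nu2 x = Fin l"
    by (rule nu2_eq_Fin_obtain)
  then show ?thesis
    using nu2_ge_two_powi_odd_iff [of a b m l] by simp
qed auto

text \<open>An exact value is a bound together with the failure of the next one, so a congruence
  modulo \<open>2 ^ (m + 1)\<close> suffices to decide it.\<close>

lemma nu2_eq_Fin_iff: "nu2 x = Fin m \<longleftrightarrow> nu2_ge m x \<and> \<not> nu2_ge (m + 1) x"
  unfolding nu2_ge_iff by (cases "nu2 x") auto

lemma nu2_mult: "nu2 (x * y) = nu2 x + nu2 y"
proof (cases "x = 0 \<or> y = 0")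
  case True
  then show ?thesis
    using nu2_neq_Minf [of x] nu2_neq_Minf [of y] by (cases "nu2 x"; cases "nu2 y") auto
next
  case False
  obtain m and a b :: int where
    x: "odd a" "odd b" "x = 2 powi m * (of_int a / of_int b)" "nu2 x = Fin m"
    using False nu2_eq_Fin_obtain [of x] by metis
  obtain l and c d :: int where
    y: "odd c" "odd d" "y = 2 powi l * (of_int c / of_int d)" "nu2 y = Fin l"
    using False nu2_eq_Fin_obtain [of y] by metis
  have xy: "x * y = 2 powi (m + l) * (of_int (a * c) / of_int (b * d))"
    unfolding x(3) y(3) by (simp add: power_int_add)
  have "odd (a * c)" "odd (b * d)" using x y by auto
  then have "nu2 (x * y) = Fin (m + l)"
    unfolding nu2_eq_Fin_iff xy by (subst (1 2) nu2_ge_two_powi_odd_iff) auto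
  then show ?thesis by (simp add: x(4) y(4))
qed

lemma nu2_ge_mult_iff:
  assumes "nu2 u = Fin e"
  shows "nu2_ge (e + m) (u * x) \<longleftrightarrow> nu2_ge m x"
  using assms unfolding nu2_ge_iff nu2_mult by (cases "nu2 x") auto

lemma nu2_two_power [simp]: "nu2 (2 ^ m) = Fin (int m)"
  using nu2_ge_two_powi_odd_iff [of 1 1 _ "int m"] unfolding nu2_eq_Fin_iff by simp

lemma nu2_minus [simp]: "nu2 (- x) = nu2 x"
proof (cases "x = 0")
  case False
  then obtain m where m: "nu2 x = Fin m" by (rule nu2_eq_Fin_obtain)
  then have "nu2 (- x) = Fin m" by (simp add: nu2_eq_Fin_iff)
  with m show ?thesis by simp
qed simp

lemma nu2_minus_one_power_mult [simp]: "nu2 ((- 1) ^ j * x) = nu2 x"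
  by (cases "even j") auto

lemma nu2_of_nat_eq_0_iff: "nu2 (of_nat a) = Fin 0 \<longleftrightarrow> odd a"
  using nu2_ge_1_of_int_iff [of "int a"] by (simp add: nu2_eq_Fin_iff)

section \<open>Binary digit sums, Legendre's formula and Kummer's theorem\<close>

lemma sigma2_0 [simp]: "sigma2 0 = 0"
  by (simp add: sigma2.simps)

lemma sigma2_even [simp]: "sigma2 (2 * m) = sigma2 m"
  by (cases "m = 0") (auto simp: sigma2.simps[of "2 * m"])

lemma sigma2_odd [simp]: "sigma2 (Suc (2 * m)) = Suc (sigma2 m)"
  by (subst sigma2.simps) simp

lemma sigma2_1 [simp]: "sigma2 (Suc 0) = 1"
  using sigma2_odd [of 0] by simp

lemma sigma2_Suc_le: "sigma2 (Suc m) \<le> Suc (sigma2 m)"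
proof (induction m rule: less_induct)
  case (less m)
  show ?case
  proof (cases "even m")
    case True
    then show ?thesis by (auto elim!: evenE)
  next
    case False
    then obtain q where q: "m = Suc (2 * q)" by (auto elim!: oddE)
    then have "sigma2 (Suc q) \<le> Suc (sigma2 q)" using less by simp
    moreover have "sigma2 (Suc m) = sigma2 (Suc q)" using sigma2_even [of "Suc q"] q by simp
    ultimately show ?thesis using q by simp
  qed
qed

text \<open>A carry in binary addition replaces two ones by a single one. The induction halves both
  numbers; two odd numbers produce a carry, which is absorbed by
  \<open>sigma2_Suc_le\<close>.\<close>

lemma sigma2_add_le: "sigma2 (a + b) \<le> sigma2 a + sigma2 b"
proof (induction a arbitrary: b rule: less_induct)
  case (less a)
  show ?case
  proof (cases "a = 0")
    case False
    obtain a' where a': "a = 2 * a' \<or> a = Suc (2 * a')" by (metis evenE oddE Suc_eq_plus1)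
    obtain b' where b': "b = 2 * b' \<or> b = Suc (2 * b')" by (metis evenE oddE Suc_eq_plus1)
    from a' False have "a' < a" by auto
    then have *: "sigma2 (a' + b') \<le> sigma2 a' + sigma2 b'" by (rule less)
    then have "sigma2 (Suc (a' + b')) \<le> Suc (sigma2 a' + sigma2 b')"
      using sigma2_Suc_le [of "a' + b'"] by linarith
    with * show ?thesis
      using a' b' sigma2_even [of "a' + b'"] sigma2_odd [of "a' + b'"] sigma2_even [of "Suc (a' + b')"]
      by (elim disjE) simp_all
  qed simp
qed

lemma sigma2_le: "sigma2 m \<le> m"
proof (induction m)
  case (Suc m)
  then show ?case using sigma2_Suc_le [of m] by linarith
qed simp

text \<open>Passing from \<open>m\<close> to \<open>Suc m\<close> clears the trailing ones of
  \<open>m\<close>, whose number is the valuation of \<open>Suc m\<close>, and sets the next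
  digit.\<close>

lemma nu2_of_nat_Suc: "nu2 (of_nat (Suc m)) = Fin (int (sigma2 m) + 1 - int (sigma2 (Suc m)))"
proof (induction m rule: less_induct)
  case (less m)
  show ?case
  proof (cases "even m")
    case True
    then have "nu2 (of_nat (Suc m)) = Fin 0" by (subst nu2_of_nat_eq_0_iff) simp
    with True show ?thesis by (auto elim!: evenE)
  next
    case False
    then obtain q where q: "m = Suc (2 * q)" by (auto elim!: oddE)
    then have IH: "nu2 (of_nat (Suc q)) = Fin (int (sigma2 q) + 1 - int (sigma2 (Suc q)))"
      using less by simp
    have m: "of_nat (Suc m) = (2 :: rat) ^ 1 * of_nat (Suc q)" using q by simp
    have "nu2 (of_nat (Suc m)) = Fin (2 + int (sigma2 q) - int (sigma2 (Suc q)))"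
      unfolding m IH nu2_mult nu2_two_power by simp
    moreover have "sigma2 (Suc m) = sigma2 (Suc q)" using sigma2_even [of "Suc q"] q by simp
    ultimately show ?thesis using q by simp
  qed
qed

text \<open>Legendre's formula: the valuations of the factors telescope in the digit sums.\<close>

lemma nu2_fact: "nu2 (fact m) = Fin (int m - int (sigma2 m))"
proof (induction m)
  case 0
  then show ?case using nu2_two_power [of 0] by simp
next
  case (Suc m)
  have "nu2 (fact (Suc m)) = nu2 (of_nat (Suc m)) + nu2 (fact m)"
    unfolding fact_Suc nu2_mult ..
  then show ?case unfolding Suc nu2_of_nat_Suc by simp
qed

lemma nu2_fact_quotient:
  "nu2 (fact m / fact r) = Fin (int m - int (sigma2 m) - (int r - int (sigma2 r)))"
proof -
  have "nu2 (fact m / fact r * fact r) = nu2 (fact m)" by simp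
  then have "nu2 (fact m / fact r) + nu2 (fact r) = nu2 (fact m)" by (simp only: nu2_mult)
  then show ?thesis unfolding nu2_fact by (cases "nu2 (fact m / fact r :: rat)") auto
qed

text \<open>Kummer's theorem in digit sum form, obtained by applying Legendre's formula to the three
  factorials.\<close>

lemma nu2_binomial:
  assumes "k \<le> n"
  shows "nu2 (of_nat (n choose k)) = Fin (int (sigma2 k) + int (sigma2 (n - k)) - int (sigma2 n))"
proof -
  have "nu2 (of_nat (n choose k) * fact (n - k)) = nu2 (fact n / fact k)"
    using assms by (simp add: binomial_fact)
  then show ?thesis
    using assms unfolding nu2_mult nu2_fact nu2_fact_quotient
    by (cases "nu2 (of_nat (n choose k))") (auto simp: of_nat_diff)
qed

section \<open>Weighted power series and powers of the logarithm\<close>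

lemma sigma2_less: "2 \<le> m \<Longrightarrow> sigma2 m < m"
proof (induction m rule: nat_induct_at_least)
  case base
  show ?case using sigma2_even [of 1] by simp
next
  case (Suc m)
  then show ?case using sigma2_Suc_le [of m] by linarith
qed

lemma sigma2_diff_le:
  assumes "i \<le> j" and "j \<le> d"
  shows "sigma2 (d - i) \<le> sigma2 (d - j) + sigma2 (j - i)"
  using sigma2_add_le [of "d - j" "j - i"] assms by simp

text \<open>A filtration of power series by divisibility, with the digit sum of the index as the
  reference level. Subadditivity of \<open>sigma2\<close> makes it multiplicative.\<close>

definition weight_ge :: "int \<Rightarrow> rat fps \<Rightarrow> bool" where
  "weight_ge c P \<longleftrightarrow> (\<forall>r. nu2_ge (int (sigma2 r) + c) (P $ r))"

lemma weight_ge_mono: "weight_ge b P \<Longrightarrow> a \<le> b \<Longrightarrow> weight_ge a P"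
  unfolding weight_ge_def by (meson add_left_mono nu2_ge_mono)

lemma weight_ge_add: "weight_ge c P \<Longrightarrow> weight_ge c Q \<Longrightarrow> weight_ge c (P + Q)"
  by (simp add: weight_ge_def nu2_ge_add)

lemma weight_ge_mult:
  assumes "weight_ge a P" and "weight_ge b Q"
  shows "weight_ge (a + b) (P * Q)"
  unfolding weight_ge_def fps_mult_nth
proof (intro allI nu2_ge_sum)
  fix r i :: nat assume "i \<in> {0..r}"
  then have "sigma2 r \<le> sigma2 i + sigma2 (r - i)"
    using sigma2_add_le [of i "r - i"] by simp
  moreover have "nu2_ge ((int (sigma2 i) + a) + (int (sigma2 (r - i)) + b)) (P $ i * Q $ (r - i))"
    using assms by (intro nu2_ge_mult) (auto simp: weight_ge_def)
  ultimately show "nu2_ge (int (sigma2 r) + (a + b)) (P $ i * Q $ (r - i))"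
    by (auto elim: nu2_ge_mono)
qed

lemma weight_ge_monom:
  "nu2_ge (int (sigma2 e) + c) a \<Longrightarrow> weight_ge c (fps_const a * fps_X ^ e)"
  by (auto simp: weight_ge_def)

section \<open>The series g = log (1 + y) / y and the coefficients of its powers\<close>

definition log_quot :: "rat fps" where
  "log_quot = Abs_fps (\<lambda>r. (- 1) ^ r / of_nat (Suc r))"

text \<open>The factor \<open>2 ^ d\<close> is the scaling y -> 2y, after which g becomes 1 + y p
  with p of weight 0.\<close>

definition log_coeff :: "nat \<Rightarrow> nat \<Rightarrow> rat" where
  "log_coeff K d = 2 ^ d * (log_quot ^ K) $ d"

text \<open>Chosen such that \<open>1 + y * log_tail = ln (1 + 2 * y) / (2 * y)\<close>.\<close>

definition log_tail :: "rat fps" where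
  "log_tail = Abs_fps (\<lambda>r. (- 2) ^ Suc r / of_nat (r + 2))"

lemma log_coeff_eq_nth: "log_coeff K d = ((1 + fps_X * log_tail) ^ K) $ d"
proof -
  have "(1 + fps_X * log_tail) = log_quot oo (fps_const 2 * fps_X)"
  proof (rule fps_ext)
    fix r
    show "(1 + fps_X * log_tail) $ r = (log_quot oo (fps_const 2 * fps_X)) $ r"
      unfolding fps_compose_linear
      by (cases r) (auto simp: log_tail_def log_quot_def fps_X_mult_nth power_mult_distrib [symmetric]
        simp del: power_Suc)
  qed
  then have "(1 + fps_X * log_tail) ^ K = (log_quot ^ K) oo (fps_const 2 * fps_X)"
    by (simp add: fps_compose_power)
  then show ?thesis
    by (simp add: fps_compose_linear log_coeff_def)
qed

lemma log_coeff_eq_sum: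
  "log_coeff K d = (\<Sum>j\<le>d. of_nat (K choose j) * (log_tail ^ j) $ (d - j))"
proof -
  let ?t = "\<lambda>j. of_nat (K choose j) * (if d < j then 0 else (log_tail ^ j) $ (d - j))"
  have "(1 + fps_X * log_tail) ^ K = (\<Sum>j\<le>K. of_nat (K choose j) * (fps_X ^ j * log_tail ^ j))"
    by (subst add.commute, subst binomial_ring) (simp add: power_mult_distrib)
  then have "log_coeff K d = (\<Sum>j\<le>K. ?t j)"
    unfolding log_coeff_eq_nth
    by (simp add: fps_sum_nth fps_X_power_mult_nth fps_of_nat [symmetric] del: fps_of_nat)
  \<comment> \<open>Terms beyond \<open>K\<close> vanish by the binomial coefficient, terms beyond
    \<open>d\<close> by the factor \<open>fps_X ^ j\<close>; both ranges embed into a common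
    one.\<close>
  also have "\<dots> = (\<Sum>j\<le>max K d. ?t j)"
    by (rule sum.mono_neutral_left) auto
  also have "\<dots> = (\<Sum>j\<le>d. ?t j)"
    by (rule sum.mono_neutral_right) auto
  finally show ?thesis by simp
qed

lemma nu2_log_tail:
  "nu2 (log_tail $ r) = Fin (int r - int (sigma2 (Suc r)) + int (sigma2 (Suc (Suc r))))"
proof -
  have "nu2 (log_tail $ r * of_nat (Suc (Suc r))) = nu2 ((- 1) ^ Suc r * 2 ^ Suc r)"
    by (simp add: log_tail_def power_mult_distrib [symmetric] del: power_Suc)
  then have "nu2 (log_tail $ r) + nu2 (of_nat (Suc (Suc r))) = Fin (int (Suc r))"
    unfolding nu2_minus_one_power_mult nu2_two_power unfolding nu2_mult .
  then show ?thesis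
    unfolding nu2_of_nat_Suc by (cases "nu2 (log_tail $ r)") auto
qed

text \<open>The coefficients of \<open>log_tail\<close> at 0 and 2 are exactly -1 and -2 and cancel.
  At every other index the valuation exceeds the digit sum by at least 1, which is checked by
  parity.\<close>

lemma weight_ge_log_tail_remainder: "weight_ge 1 (log_tail + (1 + 2 * fps_X ^ 2))"
  unfolding weight_ge_def
proof
  fix r
  show "nu2_ge (int (sigma2 r) + 1) ((log_tail + (1 + 2 * fps_X ^ 2)) $ r)"
  proof (cases "r = 0 \<or> r = 2")
    case True
    then have "(log_tail + (1 + 2 * fps_X ^ 2)) $ r = 0"
      by (auto simp: log_tail_def numeral_fps_const)
    then show ?thesis by simp
  next
    case False
    have "int (sigma2 r) + 1 \<le> int r - int (sigma2 (Suc r)) + int (sigma2 (Suc (Suc r)))"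
    proof (cases "even r")
      case True
      then obtain q where q: "r = 2 * q" by (auto elim: evenE)
      \<comment> \<open>The inequality fails only for \<open>q = 0\<close> and \<open>q = 1\<close>,
        that is, at the two excluded indices.\<close>
      with False have "sigma2 q < q" by (intro sigma2_less) auto
      then show ?thesis using q by simp
    next
      case False
      then obtain q where q: "r = Suc (2 * q)" by (auto elim: oddE)
      have "Suc r = 2 * Suc q" "Suc (Suc r) = Suc (2 * Suc q)" using q by auto
      then have "sigma2 (Suc r) = sigma2 (Suc q)" "sigma2 (Suc (Suc r)) = Suc (sigma2 (Suc q))"
        by (simp_all only: sigma2_even sigma2_odd)
      then show ?thesis using q sigma2_le [of q] by simp
    qed
    moreover have "(log_tail + (1 + 2 * fps_X ^ 2)) $ r = log_tail $ r"
      using False by (auto simp: numeral_fps_const)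
    ultimately show ?thesis by (simp add: nu2_ge_iff nu2_log_tail)
  qed
qed

lemma sigma2_2 [simp]: "sigma2 2 = 1"
  using sigma2_even [of 1] by simp

lemma weight_ge_one_plus: "weight_ge 0 (1 + of_nat (2 * j) * fps_X ^ 2)"
proof -
  have "weight_ge 0 (fps_const 1 * fps_X ^ 0 + fps_const (of_nat (2 * j)) * fps_X ^ 2)"
    using nu2_ge_1_of_int_iff [of "int (2 * j)"]
    by (intro weight_ge_add weight_ge_monom) (auto simp: nu2_ge_of_nat [of 1, simplified])
  then show ?thesis by (simp add: fps_of_nat [symmetric])
qed

lemma weight_ge_log_tail: "weight_ge 0 log_tail"
proof -
  have "weight_ge 0 (log_tail + (1 + 2 * fps_X ^ 2))"
    using weight_ge_log_tail_remainder by (rule weight_ge_mono) simp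
  moreover have "weight_ge 0 (- (1 + of_nat (2 * 1) * fps_X ^ 2))"
    using weight_ge_one_plus [of 1] unfolding weight_ge_def fps_neg_nth nu2_ge_minus_iff .
  ultimately have "weight_ge 0 (log_tail + (1 + 2 * fps_X ^ 2) + - (1 + of_nat (2 * 1) * fps_X ^ 2))"
    by (rule weight_ge_add)
  then show ?thesis by simp
qed

text \<open>In the induction, \<open>log_tail\<close> is -(1 + 2 y^2) plus a remainder of weight 1.
  The product (1 + 2 j y^2)(1 + 2 y^2) differs from 1 + 2 (j + 1) y^2 by 4 j y^4, which has weight 1
  because \<open>sigma2 4 = 1\<close>.\<close>

lemma weight_ge_log_tail_power:
  "weight_ge 1 (log_tail ^ j - (- 1) ^ j * (1 + of_nat (2 * j) * fps_X ^ 2))"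
proof (induction j)
  case 0
  then show ?case by (simp add: weight_ge_def)
next
  case (Suc j)
  let ?a = "\<lambda>j. 1 + of_nat (2 * j) * fps_X ^ 2 :: rat fps"
  let ?R = "log_tail + (1 + 2 * fps_X ^ 2)"
  have eq: "log_tail ^ Suc j - (- 1) ^ Suc j * ?a (Suc j)
      = log_tail * (log_tail ^ j - (- 1) ^ j * ?a j)
        + (- 1) ^ j * (?R * ?a j + fps_const (- (4 * of_nat j)) * fps_X ^ 4)"
  proof -
    have c: "fps_const (- (4 * of_nat j :: rat)) = - (4 * of_nat j)"
      by (simp add: fps_of_nat [symmetric] numeral_fps_const)
    show ?thesis unfolding c by (simp add: algebra_simps eval_nat_numeral)
  qed
  have "weight_ge (0 + 1) (log_tail * (log_tail ^ j - (- 1) ^ j * ?a j))"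
    by (intro weight_ge_mult weight_ge_log_tail Suc)
  moreover have "weight_ge (1 + 0) (?R * ?a j)"
    by (intro weight_ge_mult weight_ge_log_tail_remainder weight_ge_one_plus)
  moreover have "weight_ge 1 (fps_const (- (4 * of_nat j)) * fps_X ^ 4)"
  proof (rule weight_ge_monom)
    have "sigma2 4 = 1" using sigma2_even [of 2] by simp
    moreover have "nu2_ge (2 + 0) (2 ^ 2 * of_nat j)"
      using nu2_ge_mult [OF nu2_ge_two_power [of 2] nu2_ge_of_nat [of j]] by simp
    ultimately show "nu2_ge (int (sigma2 4) + 1) (- (4 * of_nat j))" by simp
  qed
  moreover have "weight_ge 1 ((- 1) ^ j * P)" if "weight_ge 1 P" for P
    using that by (cases "even j") (auto simp: weight_ge_def)
  ultimately show ?case unfolding eq by (simp add: weight_ge_add)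
qed

lemma nu2_ge_log_tail_power_nth: "nu2_ge (int (sigma2 r)) ((log_tail ^ j) $ r)"
proof -
  have "weight_ge 0 (log_tail ^ j)"
  proof (induction j)
    case 0
    show ?case using weight_ge_one_plus [of 0] by simp
  next
    case (Suc j)
    then show ?case using weight_ge_mult [OF weight_ge_log_tail Suc] by simp
  qed
  then show ?thesis by (simp add: weight_ge_def)
qed

lemma log_tail_power_nth_cong:
  "nu2_ge (int (sigma2 r) + 1) ((log_tail ^ j) $ r -
     (- 1) ^ j * (if r = 0 then 1 else if r = 2 then of_nat (2 * j) else 0))"
proof -
  have nth: "((- 1) ^ j * (1 + fps_const c * fps_X ^ 2)) $ r =
      (- 1 :: rat) ^ j * (if r = 0 then 1 else if r = 2 then c else 0)" for c
    by (cases "even j") auto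
  have "of_nat (2 * j) = fps_const (of_nat (2 * j) :: rat)" by (rule fps_of_nat [symmetric])
  with weight_ge_log_tail_power [of j, unfolded weight_ge_def fps_sub_nth, rule_format, of r]
  show ?thesis by (simp only: nth)
qed

lemma log_tail_power_nth_0: "(log_tail ^ j) $ 0 = (- 1) ^ j"
  by (induction j) (auto simp: log_tail_def)

section \<open>Congruences for the logarithmic coefficients\<close>

text \<open>The term of index \<open>i\<close> gains \<open>sigma2 (j - i)\<close> from the power of
  \<open>log_tail\<close>, and subadditivity turns the defect \<open>sigma2 (d - i)\<close> into at
  most \<open>sigma2 (d - j)\<close>.\<close>

lemma nu2_ge_log_coeff:
  assumes "\<And>j. j \<le> d \<Longrightarrow> nu2_ge (\<mu> - int (sigma2 (d - j))) (of_nat (K choose j))"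
    and "j \<le> d"
  shows "nu2_ge (\<mu> - int (sigma2 (d - j))) (log_coeff K j)"
  unfolding log_coeff_eq_sum
proof (rule nu2_ge_sum)
  fix i assume "i \<in> {..j}"
  then have i: "i \<le> j" by simp
  have "nu2_ge (\<mu> - int (sigma2 (d - i)) + int (sigma2 (j - i)))
      (of_nat (K choose i) * (log_tail ^ i) $ (j - i))"
    using i assms by (intro nu2_ge_mult nu2_ge_log_tail_power_nth) auto
  then show "nu2_ge (\<mu> - int (sigma2 (d - j))) (of_nat (K choose i) * (log_tail ^ i) $ (j - i))"
    using sigma2_diff_le [OF i assms(2)] by (auto elim: nu2_ge_mono)
qed

text \<open>The system expressing \<open>log_coeff K j\<close> by binomial coefficients is
  triangular with diagonal entries 1 or -1, so it can be solved successively without losing the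
  bound.\<close>

lemma nu2_ge_binomial_if_log_coeff:
  assumes "\<And>j. j \<le> d \<Longrightarrow> nu2_ge (\<mu> - int (sigma2 (d - j))) (log_coeff K j)"
    and "j \<le> d"
  shows "nu2_ge (\<mu> - int (sigma2 (d - j))) (of_nat (K choose j))"
  using assms(2)
proof (induction j rule: less_induct)
  case (less j)
  let ?t = "\<lambda>i. of_nat (K choose i) * (log_tail ^ i) $ (j - i)"
  have "log_coeff K j = (\<Sum>i<j. ?t i) + (- 1) ^ j * of_nat (K choose j)"
    unfolding log_coeff_eq_sum lessThan_Suc_atMost [symmetric]
    by (simp add: log_tail_power_nth_0)
  moreover have "nu2_ge (\<mu> - int (sigma2 (d - j))) (\<Sum>i<j. ?t i)"
  proof (rule nu2_ge_sum)
    fix i assume "i \<in> {..<j}"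
    then have i: "i < j" by simp
    then have "nu2_ge (\<mu> - int (sigma2 (d - i)) + int (sigma2 (j - i))) (?t i)"
      using less by (intro nu2_ge_mult nu2_ge_log_tail_power_nth) auto
    then show "nu2_ge (\<mu> - int (sigma2 (d - j))) (?t i)"
      using sigma2_diff_le [of i j d] i less.prems by (auto elim: nu2_ge_mono)
  qed
  ultimately have "nu2_ge (\<mu> - int (sigma2 (d - j)))
      ((\<Sum>i<j. ?t i) + (- 1) ^ j * of_nat (K choose j) - (\<Sum>i<j. ?t i))"
    using assms(1) [OF less.prems] by (intro nu2_ge_diff) simp_all
  then show ?case by simp
qed

text \<open>The lower bound for the binomial coefficient and the error in
  \<open>log_tail_power_nth_cong\<close> involve \<open>sigma2 (d - j)\<close> with opposite signs,
  so each product of the two vanishes modulo \<open>2 ^ (\<mu> + 1)\<close>.\<close>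

lemma log_coeff_cong:
  assumes "\<And>j. j \<le> d \<Longrightarrow> nu2_ge (\<mu> - int (sigma2 (d - j))) (of_nat (K choose j))"
  shows "nu2_ge (\<mu> + 1) (log_coeff K d - (- 1) ^ d * (of_nat (K choose d) +
    (if 2 \<le> d then 2 * of_nat ((d - 2) * (K choose (d - 2))) else 0)))"
proof -
  let ?m = "\<lambda>j. (- 1) ^ j * (if d - j = 0 then 1 else if d - j = 2 then of_nat (2 * j) else 0 :: rat)"
  have "(\<Sum>j\<le>d. of_nat (K choose j) * ?m j)
      = (\<Sum>j\<le>d. (if j = d then (- 1) ^ d * of_nat (K choose d) else 0)
          + (if j = d - 2 then if 2 \<le> d then (- 1) ^ d * (2 * of_nat ((d - 2) * (K choose (d - 2)))) else 0 else 0))"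
  proof (rule sum.cong)
    fix j assume j: "j \<in> {..d}"
    \<comment> \<open>Only the constant and the quadratic term of the model contribute, and their
      signs agree since the exponents differ by 2.\<close>
    consider "j = d" | "d = j + 2" | "j \<noteq> d" "d \<noteq> j + 2" by blast
    then show "of_nat (K choose j) * ?m j = (if j = d then (- 1) ^ d * of_nat (K choose d) else 0)
      + (if j = d - 2 then if 2 \<le> d then (- 1) ^ d * (2 * of_nat ((d - 2) * (K choose (d - 2)))) else 0 else 0)"
      using j by cases (auto simp: power_add)
  qed simp
  also have "\<dots> = (- 1) ^ d * (of_nat (K choose d) +
      (if 2 \<le> d then 2 * of_nat ((d - 2) * (K choose (d - 2))) else 0))"
    by (subst sum.distrib, subst (1 2) sum.delta) (auto simp: distrib_left)
  finally have "log_coeff K d - (- 1) ^ d * (of_nat (K choose d) +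
      (if 2 \<le> d then 2 * of_nat ((d - 2) * (K choose (d - 2))) else 0))
      = (\<Sum>j\<le>d. of_nat (K choose j) * ((log_tail ^ j) $ (d - j) - ?m j))"
    unfolding log_coeff_eq_sum by (simp add: right_diff_distrib sum_subtractf)
  moreover have "nu2_ge (\<mu> + 1) (\<Sum>j\<le>d. of_nat (K choose j) * ((log_tail ^ j) $ (d - j) - ?m j))"
  proof (rule nu2_ge_sum)
    fix j assume "j \<in> {..d}"
    then show "nu2_ge (\<mu> + 1) (of_nat (K choose j) * ((log_tail ^ j) $ (d - j) - ?m j))"
      using nu2_ge_mult [OF assms log_tail_power_nth_cong [of "d - j" j], of j] by simp
  qed
  ultimately show ?thesis by (simp only:)
qed

lemma Suc_mult_binomial_Suc: "Suc k * (n choose Suc k) = (n - k) * (n choose k)"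
  by (simp only: binomial_absorption binomial_absorb_comp)

text \<open>For odd \<open>d\<close> the bound is \<open>\<mu> - 2\<close>, and \<open>d - 3\<close>
  supplies another factor 2. For even \<open>d\<close> the bound \<open>\<mu> - 1\<close> is carried
  over from a neighbouring index, \<open>d - 4\<close> if \<open>K\<close> is odd and
  \<open>d - 2\<close> if \<open>K\<close> is even, by a ratio of consecutive binomial coefficients
  whose relevant factor is odd.\<close>

lemma nu2_ge_binomial_diff_3:
  assumes "\<And>j. j \<le> d \<Longrightarrow> nu2_ge (\<mu> - int (sigma2 (d - j))) (of_nat (K choose j))"
    and "3 \<le> d"
  shows "nu2_ge \<mu> (2 * of_nat ((d - 3) * (K choose (d - 3))))"
proof (cases "even d")
  case False
  have "sigma2 3 = 2" using sigma2_odd [of 1] by (simp add: eval_nat_numeral)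
  then have *: "nu2_ge (\<mu> - 2) (of_nat (K choose (d - 3)))"
    using assms(1) [of "d - 3"] assms(2) by simp
  from False assms(2) obtain e where e: "d - 3 = 2 * e"
    by (metis dvdE even_diff_nat odd_numeral odd_even_add)
  have "2 * of_nat ((d - 3) * (K choose (d - 3))) = (2 :: rat) ^ 2 * (of_nat e * of_nat (K choose (d - 3)))"
    unfolding e by simp
  moreover have "nu2_ge (int 2 + (\<mu> - 2)) (2 ^ 2 * (of_nat e * of_nat (K choose (d - 3))))"
    by (intro nu2_ge_mult nu2_ge_two_power nu2_ge_mult_of_nat *)
  ultimately have "nu2_ge (int 2 + (\<mu> - 2)) (2 * of_nat ((d - 3) * (K choose (d - 3))))"
    by (simp only:)
  then show ?thesis by simp
next
  case True
  then obtain e where "d = 2 * e" by (auto elim: evenE)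
  with assms(2) have "d = Suc (Suc (Suc (Suc (2 * (e - 2)))))" by simp
  then obtain q where q: "d = Suc (Suc (Suc (Suc (2 * q))))" by blast
  have s: "sigma2 4 = 1" using sigma2_even [of 2] by simp
  have "nu2_ge (\<mu> - 1) (of_nat (K choose Suc (2 * q)))"
  proof (cases "2 * q \<le> K")
    case True
    show ?thesis
    proof (cases "even K")
      case False
      have "of_int (int (Suc (2 * q))) * of_nat (K choose Suc (2 * q))
          = (of_nat ((K - 2 * q) * (K choose (2 * q))) :: rat)"
        using Suc_mult_binomial_Suc [of "2 * q" K] by (simp only: of_int_of_nat_eq of_nat_mult [symmetric])
      moreover have "nu2_ge (\<mu> - 1) (of_nat ((K - 2 * q) * (K choose (2 * q))))"
        using nu2_ge_mult_of_nat [OF assms(1) [of "2 * q"], of "K - 2 * q"] q s by simp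
      ultimately have "nu2_ge (\<mu> - 1) (of_int (int (Suc (2 * q))) * of_nat (K choose Suc (2 * q)))"
        by (simp only:)
      then show ?thesis by (subst (asm) nu2_ge_odd_mult_iff) auto
    next
      case True
      show ?thesis
      proof (cases "Suc (2 * q) \<le> K")
        case False
        then show ?thesis by (simp add: binomial_eq_0)
      next
        case le: True
        have "of_int (int (K - Suc (2 * q))) * of_nat (K choose Suc (2 * q))
            = (of_nat (Suc (Suc (2 * q)) * (K choose Suc (Suc (2 * q)))) :: rat)"
          using Suc_mult_binomial_Suc [of "Suc (2 * q)" K] by (simp only: of_int_of_nat_eq of_nat_mult [symmetric])
        moreover have "nu2_ge (\<mu> - 1) (of_nat (Suc (Suc (2 * q)) * (K choose Suc (Suc (2 * q)))))"
          unfolding of_nat_mult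
        proof (rule nu2_ge_mult_of_nat)
          have "d - Suc (Suc (2 * q)) = 2" using q by simp
          then show "nu2_ge (\<mu> - 1) (of_nat (K choose Suc (Suc (2 * q))))"
            using assms(1) [of "Suc (Suc (2 * q))"] q by simp
        qed
        ultimately have "nu2_ge (\<mu> - 1) (of_int (int (K - Suc (2 * q))) * of_nat (K choose Suc (2 * q)))"
          by (simp only:)
        then show ?thesis using True le by (subst (asm) nu2_ge_odd_mult_iff) auto
      qed
    qed
  qed (simp add: binomial_eq_0)
  then have "nu2_ge (\<mu> - 1) (of_nat (d - 3) * of_nat (K choose (d - 3)))"
    using q by (intro nu2_ge_mult_of_nat) (simp add: numeral_3_eq_3)
  then show ?thesis by (simp add: nu2_ge_two_mult_iff)
qed

text \<open>The congruence is applied at \<open>d - 1\<close> with \<open>\<mu> - 1\<close>; its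
  correction term, of index \<open>d - 3\<close>, is then removed by
  \<open>nu2_ge_binomial_diff_3\<close>.\<close>

lemma log_coeff_pred_cong:
  assumes "\<And>j. j \<le> d \<Longrightarrow> nu2_ge (\<mu> - int (sigma2 (d - j))) (of_nat (K choose j))"
    and "1 \<le> d"
  shows "nu2_ge \<mu> (log_coeff K (d - 1) - (- 1) ^ (d - 1) * of_nat (K choose (d - 1)))"
proof -
  let ?e = "if 2 \<le> d - 1 then 2 * of_nat ((d - 1 - 2) * (K choose (d - 1 - 2))) else 0 :: rat"
  \<comment> \<open>Lowering \<open>d\<close> by one lowers the digit sum of the distance to
    \<open>j\<close> by at most 1, which is paid for by replacing \<open>\<mu>\<close> with
    \<open>\<mu> - 1\<close>.\<close>
  have "nu2_ge (\<mu> - 1 - int (sigma2 (d - 1 - j))) (of_nat (K choose j))" if "j \<le> d - 1" for j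
  proof (rule nu2_ge_mono)
    have "Suc (d - 1 - j) = d - j" using that assms(2) by simp
    then have "sigma2 (d - j) \<le> Suc (sigma2 (d - 1 - j))"
      using sigma2_Suc_le [of "d - 1 - j"] by simp
    then show "\<mu> - 1 - int (sigma2 (d - 1 - j)) \<le> \<mu> - int (sigma2 (d - j))" by simp
    show "nu2_ge (\<mu> - int (sigma2 (d - j))) (of_nat (K choose j))"
      using assms(1) that by simp
  qed
  from log_coeff_cong [OF this]
  have 1: "nu2_ge \<mu> (log_coeff K (d - 1) - (- 1) ^ (d - 1) * (of_nat (K choose (d - 1)) + ?e))"
    by simp
  have "nu2_ge \<mu> ?e"
  proof (cases "3 \<le> d")
    case True
    then have "d - 1 - 2 = d - 3" "2 \<le> d - 1" by simp_all
    with nu2_ge_binomial_diff_3 [OF assms(1) True] show ?thesis by (simp only: if_True)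
  next
    case False
    then have "\<not> 2 \<le> d - 1" by simp
    then show ?thesis by simp
  qed
  then have "nu2_ge \<mu> ((- 1) ^ (d - 1) * ?e)" by simp
  from nu2_ge_add [OF 1 this] show ?thesis by (simp only: distrib_left diff_add_eq diff_diff_eq2 add_diff_cancel_right)
qed

lemma log_coeff_0: "log_coeff K 0 = 1"
  by (simp add: log_coeff_eq_sum)

text \<open>The analogue of \<open>log_coeff\<close> for g^K / (1 + y): after y -> 2y the geometric
  series has the coefficients \<open>(- 2) ^ i\<close>.\<close>

definition log_coeff_shift :: "nat \<Rightarrow> nat \<Rightarrow> rat" where
  "log_coeff_shift K d = (\<Sum>j\<le>d. (- 2) ^ (d - j) * log_coeff K j)"

text \<open>With \<open>i = d - j\<close>, a term has valuation at least
  \<open>\<mu> + i - sigma2 i\<close>, and \<open>sigma2 i < i\<close> as soon as \<open>i\<close>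
  is at least 2. So only \<open>i = 0\<close> and \<open>i = 1\<close> survive.\<close>

lemma log_coeff_shift_cong:
  assumes "\<And>j. j \<le> d \<Longrightarrow> nu2_ge (\<mu> - int (sigma2 (d - j))) (of_nat (K choose j))"
  shows "nu2_ge (\<mu> + 1) (log_coeff_shift K d - (log_coeff K d -
    (if 1 \<le> d then 2 * log_coeff K (d - 1) else 0)))"
proof -
  let ?t = "\<lambda>j. (- 2) ^ (d - j) * log_coeff K j"
  have "log_coeff_shift K d - (log_coeff K d - (if 1 \<le> d then 2 * log_coeff K (d - 1) else 0))
    = (\<Sum>j\<in>{..d} - {d, d - 1}. ?t j)"
  \<comment> \<open>For \<open>d = 0\<close> truncated subtraction collapses
    \<open>{d, d - 1}\<close> to one element.\<close>
  proof (cases "d = 0")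
    case False
    have "log_coeff_shift K d = (\<Sum>j\<in>{..d} - {d, d - 1}. ?t j) + (\<Sum>j\<in>{d, d - 1}. ?t j)"
      unfolding log_coeff_shift_def by (subst sum.subset_diff [of "{d, d - 1}"]) auto
    with False show ?thesis by simp
  qed (simp add: log_coeff_shift_def)
  moreover have "nu2_ge (\<mu> + 1) (\<Sum>j\<in>{..d} - {d, d - 1}. ?t j)"
  proof (rule nu2_ge_sum)
    fix j assume j: "j \<in> {..d} - {d, d - 1}"
    then have "j \<le> d" "sigma2 (d - j) < d - j" by (auto intro!: sigma2_less)
    moreover have "nu2_ge (int (d - j)) ((- 2) ^ (d - j))"
      using nu2_ge_two_power [of "d - j"] by (cases "even (d - j)") auto
    ultimately have "nu2_ge (int (d - j) + (\<mu> - int (sigma2 (d - j)))) (?t j)"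
      using nu2_ge_log_coeff [OF assms] by (intro nu2_ge_mult) auto
    then show "nu2_ge (\<mu> + 1) (?t j)"
      by (rule nu2_ge_mono) (use \<open>sigma2 (d - j) < d - j\<close> in linarith)
  qed
  ultimately show ?thesis by (simp only:)
qed

text \<open>An integer lower index removes the restriction \<open>i \<le> d\<close>, as a
  coefficient with negative lower index is 0.\<close>

lemma nu2_ge_binom:
  assumes "\<And>j. j \<le> d \<Longrightarrow> nu2_ge (\<mu> - int (sigma2 (d - j))) (of_nat (K choose j))"
  shows "nu2_ge (\<mu> - int (sigma2 i)) (of_nat (binom K (int d - int i)))"
proof (cases "i \<le> d")
  case True
  then have "binom K (int d - int i) = K choose (d - i)"
    by (simp add: binom_def nat_diff_distrib)
  with assms [of "d - i"] True show ?thesis by simp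
qed (simp add: binom_def)

text \<open>Replacing the factor \<open>d - 2\<close> by \<open>d\<close> costs four times a
  binomial coefficient of valuation at least \<open>\<mu> - 1\<close>, which is negligible.\<close>

lemma log_coeff_cong_binom:
  assumes "\<And>j. j \<le> d \<Longrightarrow> nu2_ge (\<mu> - int (sigma2 (d - j))) (of_nat (K choose j))"
  shows "nu2_ge (\<mu> + 1) ((- 1) ^ d * log_coeff K d -
    (of_nat (binom K (int d)) + 2 * (of_nat d * of_nat (binom K (int d - 2)))))"
proof -
  have sq: "(- 1) ^ d * ((- 1) ^ d * x) = x" for x :: rat
    by (cases "even d") auto
  let ?b = "of_nat (binom K (int d - 2)) :: rat"
  let ?c = "of_nat (K choose d) + (if 2 \<le> d then 2 * of_nat ((d - 2) * (K choose (d - 2))) else 0) :: rat"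
  have "?c = of_nat (binom K (int d)) + 2 * (of_nat d * ?b) - 2 ^ 2 * ?b"
  proof (cases "2 \<le> d")
    case True
    then have "binom K (int d - 2) = K choose (d - 2)"
      by (simp add: binom_def nat_diff_distrib)
    moreover have "of_nat (d - 2) = (of_nat d - 2 :: rat)"
      using True by (simp add: of_nat_diff)
    ultimately show ?thesis
      using True by (simp add: binom_def left_diff_distrib right_diff_distrib)
  qed (simp add: binom_def)
  then have "(- 1) ^ d * log_coeff K d - (of_nat (binom K (int d)) + 2 * (of_nat d * ?b))
      = (- 1) ^ d * (log_coeff K d - (- 1) ^ d * ?c) - 2 ^ 2 * ?b"
    by (simp add: right_diff_distrib sq)
  moreover have "nu2_ge (\<mu> + 1) ((- 1) ^ d * (log_coeff K d - (- 1) ^ d * ?c))"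
    using log_coeff_cong [OF assms] by simp
  moreover have "nu2_ge (int 2 + (\<mu> - 1)) (2 ^ 2 * ?b)"
    using nu2_ge_binom [OF assms, of 2] by (intro nu2_ge_mult nu2_ge_two_power) simp
  then have "nu2_ge (\<mu> + 1) (2 ^ 2 * ?b)" by (rule nu2_ge_mono) simp
  ultimately show ?thesis by (simp only: nu2_ge_diff)
qed

text \<open>Three congruences are added: for \<open>log_coeff\<close> at \<open>d\<close>, for the
  passage to \<open>log_coeff_shift\<close>, and for \<open>log_coeff\<close> at
  \<open>d - 1\<close>. The last is needed only modulo \<open>2 ^ \<mu>\<close> because it enters
  doubled.\<close>

lemma log_coeff_shift_cong_binom:
  assumes "\<And>j. j \<le> d \<Longrightarrow> nu2_ge (\<mu> - int (sigma2 (d - j))) (of_nat (K choose j))"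
  shows "nu2_ge (\<mu> + 1) ((- 1) ^ d * log_coeff_shift K d -
    (of_nat (binom K (int d)) + 2 * of_nat (binom K (int d - 1)) +
      2 * (of_nat d * of_nat (binom K (int d - 2)))))"
proof (cases "d = 0")
  case True
  then show ?thesis
    by (simp add: log_coeff_shift_def log_coeff_0 binom_def)
next
  case False
  let ?A = "(- 1) ^ d * log_coeff K d -
    (of_nat (binom K (int d)) + 2 * (of_nat d * of_nat (binom K (int d - 2))))"
  let ?B = "(- 1) ^ d * (log_coeff_shift K d - (log_coeff K d - 2 * log_coeff K (d - 1)))"
  let ?C = "2 * ((- 1) ^ (d - 1) * (log_coeff K (d - 1) - (- 1) ^ (d - 1) * of_nat (K choose (d - 1))))"
  have "nu2_ge (\<mu> + 1) ?A" by (rule log_coeff_cong_binom [OF assms])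
  moreover have "nu2_ge (\<mu> + 1) ?B"
    using log_coeff_shift_cong [OF assms] False by simp
  moreover have "nu2_ge (\<mu> + 1) ?C"
    using log_coeff_pred_cong [OF assms] False by (simp add: nu2_ge_two_mult_iff)
  ultimately have "nu2_ge (\<mu> + 1) (?A + ?B + ?C)" by (intro nu2_ge_add)
  moreover have "binom K (int d - 1) = K choose (d - 1)"
    using False by (simp add: binom_def nat_diff_distrib)
  moreover have "(- 1) ^ d = - ((- 1) ^ (d - 1) :: rat)"
    using False by (cases d) auto
  \<comment> \<open>Here \<open>s\<close> is the sign \<open>(- 1) ^ (d - 1)\<close>; the
    intermediate values \<open>L\<close> and \<open>P\<close> cancel.\<close>
  moreover have "- s * L - (b + 2 * x) + - s * (S - (L - 2 * P)) + 2 * (s * (P - s * c))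
      = - s * S - (b + 2 * c + 2 * x)" if "s = 1 \<or> s = - 1" for s L b x S P c :: rat
    using that by (elim disjE) (simp_all add: algebra_simps)
  moreover have "(- 1) ^ (d - 1) = (1 :: rat) \<or> (- 1) ^ (d - 1) = (- 1 :: rat)"
    by (cases "even (d - 1)") auto
  ultimately show ?thesis by (simp only:)
qed

section \<open>Stirling numbers and change of variable\<close>

lemma log_quot_0: "log_quot $ 0 = 1"
  by (simp add: log_quot_def)

lemma fps_ln_eq_log_quot: "fps_ln 1 = fps_X * log_quot"
proof (rule fps_ext)
  fix n
  show "fps_ln 1 $ n = (fps_X * log_quot) $ n"
    by (cases n) (simp_all add: fps_ln_nth log_quot_def)
qed

lemma fps_ln_power_nth: "(fps_ln 1 ^ k) $ (k + d) = (log_quot ^ k) $ d"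
  by (simp add: fps_ln_eq_log_quot power_mult_distrib fps_X_power_mult_nth)

lemma fps_deriv_ln_power:
  "fps_deriv (fps_ln 1 ^ Suc k) = of_nat (Suc k) * (fps_ln 1 ^ k * inverse (1 + fps_X :: rat fps))"
  by (simp only: fps_deriv_power' diff_Suc_1) (simp add: fps_ln_deriv mult_ac)

text \<open>Coefficient comparison in (1 + y) (L^(k+1))' = (k + 1) L^k with L = log (1 + y). Up to
  signs and factorials this is the recurrence of the Stirling numbers.\<close>

lemma fps_ln_power_recurrence:
  "of_nat (Suc n) * (fps_ln 1 ^ Suc k) $ Suc n + of_nat n * (fps_ln 1 ^ Suc k) $ n
    = of_nat (Suc k) * (fps_ln (1 :: rat) ^ k) $ n"
proof -
  let ?L = "fps_ln (1 :: rat)"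
  have "inverse (1 + fps_X :: rat fps) * (1 + fps_X) = 1" by (rule inverse_mult_eq_1) simp
  then have "fps_deriv (?L ^ Suc k) * (1 + fps_X) = of_nat (Suc k) * ?L ^ k"
    unfolding fps_deriv_ln_power by (simp only: mult.assoc mult_1_right)
  then have "fps_deriv (?L ^ Suc k) + fps_X * fps_deriv (?L ^ Suc k) = fps_const (of_nat (Suc k)) * ?L ^ k"
    by (simp only: distrib_left mult_1_right mult.commute [of fps_X] fps_of_nat)
  then have "(fps_deriv (?L ^ Suc k) + fps_X * fps_deriv (?L ^ Suc k)) $ n
      = of_nat (Suc k) * (?L ^ k) $ n"
    by (simp only: fps_mult_left_const_nth)
  moreover have "(fps_X * fps_deriv (?L ^ Suc k)) $ n = of_nat n * (?L ^ Suc k) $ n"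
    by (cases n) (simp_all only: fps_X_mult_nth fps_deriv_nth, simp_all)
  moreover have "fps_deriv (?L ^ Suc k) $ n = of_nat (Suc n) * (?L ^ Suc k) $ Suc n"
    by (simp only: fps_deriv_nth Suc_eq_plus1)
  ultimately show ?thesis by (simp only: fps_add_nth)
qed

lemma fps_ln_power_stirling:
  "(fps_ln 1 ^ k) $ n * fact n = (- 1 :: rat) ^ (n + k) * (fact k * of_nat (stirling n k))"
proof (induction n arbitrary: k)
  case 0
  show ?case by (cases k) (auto simp: fps_power_zeroth)
next
  case (Suc n)
  show ?case
  proof (cases k)
    case 0
    then show ?thesis by simp
  next
    case (Suc l)
    let ?a = "\<lambda>k n. (fps_ln (1 :: rat) ^ k) $ n"
    have "?a (Suc l) (Suc n) * fact (Suc n) = (of_nat (Suc n) * ?a (Suc l) (Suc n)) * fact n"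
      by (simp only: fact_Suc mult_ac)
    also have "of_nat (Suc n) * ?a (Suc l) (Suc n) = of_nat (Suc l) * ?a l n - of_nat n * ?a (Suc l) n"
      using fps_ln_power_recurrence [of n l] by (simp only: eq_diff_eq)
    also have "(of_nat (Suc l) * ?a l n - of_nat n * ?a (Suc l) n) * fact n
        = of_nat (Suc l) * (?a l n * fact n) - of_nat n * (?a (Suc l) n * fact n)"
      by (simp only: left_diff_distrib mult.assoc)
    also have "\<dots> = (- 1) ^ (Suc n + Suc l) * (fact (Suc l) * of_nat (stirling (Suc n) (Suc l)))"
      unfolding Suc.IH by (simp add: algebra_simps)
    finally show ?thesis unfolding Suc .
  qed
qed

lemma log_quot_power_stirling:
  "(log_quot ^ k) $ d * fact (k + d) = (- 1) ^ d * (fact k * of_nat (stirling (k + d) k))"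
  using fps_ln_power_stirling [of k "k + d"] unfolding fps_ln_power_nth
  by (simp add: power_add flip: mult_2_right power_mult_distrib)

text \<open>By Legendre's formula the linear parts of the factorials cancel against the scaling
  \<open>2 ^ d\<close>, which leaves exactly the valuation required of a SMZC as the finite
  offset.\<close>

lemma nu2_stirling:
  "nu2 (of_nat (stirling (k + d) k))
    = Fin (int (sigma2 k) - int (sigma2 (k + d))) + nu2 (log_coeff k d)"
proof -
  let ?s = "of_nat (stirling (k + d) k) :: rat"
  have "(- 1) ^ d * (?s * (fact k * 2 ^ d)) = 2 ^ d * ((- 1) ^ d * (fact k * ?s))"
    by (simp only: mult_ac)
  also have "\<dots> = fact (k + d) * log_coeff k d"
    unfolding log_quot_power_stirling [symmetric] log_coeff_def by (simp only: mult_ac)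
  finally have "nu2 ((- 1) ^ d * (?s * (fact k * 2 ^ d))) = nu2 (fact (k + d) * log_coeff k d)"
    by (rule arg_cong)
  then have "nu2 ?s + (nu2 (fact k) + nu2 (2 ^ d)) = nu2 (fact (k + d)) + nu2 (log_coeff k d)"
    unfolding nu2_minus_one_power_mult unfolding nu2_mult .
  then show ?thesis
    unfolding nu2_fact nu2_two_power
    by (cases "nu2 ?s"; cases "nu2 (log_coeff k d)") auto
qed

lemma log_coeff_shift_eq: "log_coeff_shift K d = 2 ^ d * (log_quot ^ K * inverse (1 + fps_X)) $ d"
proof -
  have "(- 2) ^ (d - j) * log_coeff K j = 2 ^ d * ((log_quot ^ K) $ j * (- 1) ^ (d - j))"
    if "j \<le> d" for j
  proof -
    have "(2 :: rat) ^ d = 2 ^ (d - j) * 2 ^ j" using that by (simp flip: power_add)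
    moreover have "(- 2 :: rat) ^ (d - j) = 2 ^ (d - j) * (- 1) ^ (d - j)"
      by (simp flip: power_mult_distrib)
    ultimately show ?thesis by (simp add: log_coeff_def mult_ac)
  qed
  then show ?thesis
    unfolding log_coeff_shift_def fps_mult_nth fps_inverse_fps_X_plus1 sum_distrib_left
    by (intro sum.cong) auto
qed

text \<open>Differentiating L^(K+1), where L = log (1 + y), trades the power \<open>Suc K\<close> of
  g for g^K / (1 + y), so that the exponent matches the Bernoulli polynomial of order
  \<open>K + d + 1\<close>.\<close>

lemma log_quot_power_stirling_shift:
  "(log_quot ^ K * inverse (1 + fps_X)) $ d * fact (K + d)
    = (- 1) ^ d * (fact K * of_nat (stirling (Suc K + d) (Suc K)))"
proof -
  let ?s = "of_nat (stirling (Suc K + d) (Suc K)) :: rat"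
  let ?b = "(log_quot ^ K * inverse (1 + fps_X)) $ d"
  have "fps_deriv (fps_ln 1 ^ Suc K) $ (K + d) = of_nat (Suc K) * ?b"
    unfolding fps_deriv_ln_power unfolding fps_ln_eq_log_quot power_mult_distrib mult.assoc fps_of_nat [symmetric]
    by (simp only: fps_mult_left_const_nth fps_X_power_mult_nth) simp
  then have "of_nat (Suc (K + d)) * (log_quot ^ Suc K) $ d = of_nat (Suc K) * ?b"
    using fps_ln_power_nth [of "Suc K" d] by (simp only: fps_deriv_nth add_Suc Suc_eq_plus1 [symmetric])
  then have "of_nat (Suc K) * (?b * fact (K + d)) = (log_quot ^ Suc K) $ d * fact (Suc K + d)"
    by (simp only: fact_Suc add_Suc mult_ac)
  also have "\<dots> = of_nat (Suc K) * ((- 1) ^ d * (fact K * ?s))"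
    unfolding log_quot_power_stirling by (simp only: fact_Suc mult_ac)
  finally show ?thesis by (simp only: mult_cancel_left) simp
qed

lemma nu2_stirling_Suc:
  "nu2 (of_nat (stirling (Suc K + d) (Suc K)))
    = Fin (int (sigma2 K) - int (sigma2 (K + d))) + nu2 (log_coeff_shift K d)"
proof -
  let ?s = "of_nat (stirling (Suc K + d) (Suc K)) :: rat"
  have "(- 1) ^ d * (?s * (fact K * 2 ^ d)) = 2 ^ d * ((- 1) ^ d * (fact K * ?s))"
    by (simp only: mult_ac)
  also have "\<dots> = fact (K + d) * log_coeff_shift K d"
    unfolding log_quot_power_stirling_shift [symmetric] log_coeff_shift_eq by (simp only: mult_ac)
  finally have "nu2 ((- 1) ^ d * (?s * (fact K * 2 ^ d))) = nu2 (fact (K + d) * log_coeff_shift K d)"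
    by (rule arg_cong)
  then have "nu2 ?s + (nu2 (fact K) + nu2 (2 ^ d)) = nu2 (fact (K + d)) + nu2 (log_coeff_shift K d)"
    unfolding nu2_minus_one_power_mult unfolding nu2_mult .
  then show ?thesis
    unfolding nu2_fact nu2_two_power
    by (cases "nu2 ?s"; cases "nu2 (log_coeff_shift K d)") auto
qed

text \<open>Invariance of the residue of \<open>F / t ^ (m + 1)\<close> under \<open>t = y * g\<close>.\<close>

lemma fps_nth_change_of_variable:
  fixes F g :: "'a :: field_char_0 fps"
  assumes g0: "g $ 0 = 1"
  shows "F $ m = ((F oo (fps_X * g)) * (fps_deriv (fps_X * g) * inverse g ^ Suc m)) $ m"
proof -
  let ?h = "fps_X * g" and ?i = "inverse g"
  let ?W = "fps_deriv ?h * ?i ^ Suc m"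
  have gi: "g * ?i = 1" using inverse_mult_eq_1 [of g] g0 by (simp add: mult.commute)
  \<comment> \<open>With h = y g this is the residue of h' / h^(r+1). For positive \<open>r\<close>
    the quotient is an exact derivative up to a constant, which is expressed here by the derivative
    of g^(-r).\<close>
  have res: "(fps_deriv ?h * ?i ^ Suc r) $ r = (if r = 0 then 1 else 0)" for r
  proof (cases r)
    case 0
    then show ?thesis using g0 by simp
  next
    case (Suc s)
    have "fps_deriv (?i ^ r) = of_nat r * (- (fps_deriv g * ?i ^ 2)) * ?i ^ (r - 1)"
      unfolding fps_deriv_power' using fps_inverse_deriv [of g] g0 by simp
    also have "\<dots> = of_nat r * (- (fps_deriv g * ?i ^ Suc r))"
      unfolding Suc by (simp add: power2_eq_square mult_ac)
    finally have d: "fps_deriv (?i ^ r) = fps_const (of_nat r) * (- (fps_deriv g * ?i ^ Suc r))"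
      by (simp only: fps_of_nat)
    have "of_nat r * (?i ^ r) $ r = fps_deriv (?i ^ r) $ s"
      by (simp only: fps_deriv_nth Suc Suc_eq_plus1)
    also have "\<dots> = of_nat r * (- ((fps_deriv g * ?i ^ Suc r) $ s))"
      unfolding d by (simp only: fps_mult_left_const_nth fps_neg_nth)
    finally have "of_nat r * (?i ^ r) $ r = of_nat r * (- ((fps_deriv g * ?i ^ Suc r) $ s))" .
    moreover have "of_nat r \<noteq> (0 :: 'a)" using Suc by (simp only: of_nat_eq_0_iff)
    ultimately have 1: "(?i ^ r) $ r = - ((fps_deriv g * ?i ^ Suc r) $ s)"
      by (simp only: mult_cancel_left simp_thms)
    have "fps_deriv ?h * ?i ^ Suc r = (g * ?i) * ?i ^ r + fps_X * (fps_deriv g * ?i ^ Suc r)"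
      by (simp add: algebra_simps)
    then show ?thesis
      unfolding gi using 1 Suc by (simp only: fps_add_nth mult_1_left fps_X_mult_nth) simp
  qed
  \<comment> \<open>Pairing with \<open>?W\<close> extracts the coefficient of
    \<open>?h ^ m\<close>: cancelling powers of g reduces the claim to the residue with
    \<open>r = m - i\<close>.\<close>
  have delta: "(?h ^ i * ?W) $ m = (if i = m then 1 else 0)" if "i \<le> m" for i
  proof -
    have "?i ^ Suc m = ?i ^ i * ?i ^ Suc (m - i)"
      using that by (simp flip: power_add power_Suc add: Suc_diff_le)
    then have "?h ^ i * ?W = fps_X ^ i * ((g * ?i) ^ i * (fps_deriv ?h * ?i ^ Suc (m - i)))"
      by (simp only: power_mult_distrib mult_ac)
    then have "(?h ^ i * ?W) $ m = (fps_X ^ i * (fps_deriv ?h * ?i ^ Suc (m - i))) $ m"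
      unfolding gi by (simp only: power_one mult_1_left)
    then show ?thesis
      unfolding fps_X_power_mult_nth res using that by auto
  qed
  have "((F oo ?h) * ?W) $ m = (\<Sum>n = 0..m. (\<Sum>i = 0..n. F $ i * (?h ^ i) $ n) * ?W $ (m - n))"
    by (simp only: fps_mult_nth [of "F oo ?h"] fps_compose_nth)
  \<comment> \<open>The power \<open>?h ^ i\<close> starts at degree \<open>i\<close>, so the inner
    range can be made independent of \<open>n\<close> and the sums interchanged.\<close>
  also have "\<dots> = (\<Sum>n = 0..m. (\<Sum>i = 0..m. F $ i * (?h ^ i) $ n) * ?W $ (m - n))"
  proof (rule sum.cong)
    fix n assume "n \<in> {0..m}"
    moreover have "(?h ^ i) $ n = 0" if "n < i" for i
      using that by (simp add: power_mult_distrib fps_X_power_mult_nth)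
    ultimately have "(\<Sum>i = 0..n. F $ i * (?h ^ i) $ n) = (\<Sum>i = 0..m. F $ i * (?h ^ i) $ n)"
      by (intro sum.mono_neutral_left) auto
    then show "(\<Sum>i = 0..n. F $ i * (?h ^ i) $ n) * ?W $ (m - n)
        = (\<Sum>i = 0..m. F $ i * (?h ^ i) $ n) * ?W $ (m - n)" by (rule arg_cong)
  qed simp
  also have "\<dots> = (\<Sum>i = 0..m. F $ i * (?h ^ i * ?W) $ m)"
    unfolding sum_distrib_right fps_mult_nth [of "?h ^ _"] sum_distrib_left
    by (subst sum.swap) (simp only: mult.assoc)
  also have "\<dots> = (\<Sum>i = 0..m. if i = m then F $ i else 0)"
    by (rule sum.cong [OF refl], subst delta) auto
  finally show ?thesis by simp
qed

section \<open>Poles of the higher order Bernoulli polynomials\<close>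

lemma fps_exp_1_minus_1_compose_ln: "(fps_exp 1 - 1) oo fps_ln (1 :: 'a :: field_char_0) = fps_X"
  unfolding fps_ln_fps_exp_inv [OF one_neq_zero] by (rule fps_inv_right) auto

text \<open>Under t = log (1 + y) the denominator e^t - 1 becomes y. Divisibility of the series is
  what allows composition to distribute over the quotient.\<close>

lemma bernoulli_fps_compose_ln: "(fps_X / (fps_exp 1 - 1)) oo fps_ln 1 = log_quot"
proof -
  have e: "subdegree (fps_exp 1 - 1 :: rat fps) = 1"
    by (rule subdegreeI) auto
  then have "(fps_exp 1 - 1 :: rat fps) dvd fps_X"
    by (subst fps_dvd_iff) (auto simp: fps_eq_iff)
  then have "(fps_X / (fps_exp 1 - 1)) oo fps_ln (1 :: rat) = (fps_X oo fps_ln 1) / ((fps_exp 1 - 1) oo fps_ln 1)"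
    by (rule fps_compose_divide_distrib) (simp_all add: fps_exp_1_minus_1_compose_ln)
  also have "\<dots> = fps_ln 1 / fps_X"
    by (simp add: fps_exp_1_minus_1_compose_ln fps_X_fps_compose_startby0)
  also have "\<dots> = log_quot" by (simp add: fps_ln_eq_log_quot fps_eq_iff)
  finally show ?thesis .
qed

lemma fps_exp_of_nat_compose_ln: "fps_exp (of_nat N) oo fps_ln (1 :: 'a :: field_char_0) = (1 + fps_X) ^ N"
proof -
  have "fps_exp 1 oo fps_ln (1 :: 'a) = 1 + ((fps_exp 1 - 1) oo fps_ln 1)"
    by (simp add: fps_compose_sub_distrib)
  also have "\<dots> = 1 + fps_X" unfolding fps_exp_1_minus_1_compose_ln ..
  finally show ?thesis
    using fps_exp_power_mult [of 1 N] by (metis fps_compose_power fps_ln_0 mult.right_neutral)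
qed

lemma poly_higher_bernpoly:
  "poly (higher_bernpoly l m) x = fact m * ((fps_X / (fps_exp 1 - 1)) powi l * fps_exp x) $ m"
  by (simp add: higher_bernpoly_def fps_mult_nth poly_sum poly_monom sum_distrib_left)

text \<open>The change of variable contributes g^(-(m+1)) / (1 + y), so the order
  \<open>K + m + 1\<close> leaves g^K and the argument \<open>Suc N\<close> leaves (1 +
  y)^N.\<close>

lemma bernoulli_fps_power_mult_exp_nth:
  "((fps_X / (fps_exp 1 - 1)) ^ (K + m + 1) * fps_exp (of_nat (Suc N))) $ m
    = (log_quot ^ K * (1 + fps_X) ^ N) $ m"
proof -
  let ?E = "fps_X / (fps_exp 1 - 1) :: rat fps" and ?i = "inverse log_quot"
  have i: "log_quot * ?i = 1"
    using inverse_mult_eq_1 [of log_quot] by (simp add: log_quot_0 mult.commute)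
  have x: "(1 + fps_X) * inverse (1 + fps_X :: rat fps) = 1"
    using inverse_mult_eq_1 [of "1 + fps_X :: rat fps"] by (simp add: mult.commute)
  have "((?E ^ (K + m + 1) * fps_exp (of_nat (Suc N))) oo fps_ln 1) * (fps_deriv (fps_ln 1) * ?i ^ Suc m)
    = (log_quot ^ (K + m + 1) * (1 + fps_X) ^ Suc N) * (inverse (1 + fps_X) * ?i ^ Suc m)"
    by (simp only: fps_compose_mult_distrib [OF fps_ln_0] fps_compose_power [OF fps_ln_0, symmetric]
      bernoulli_fps_compose_ln fps_exp_of_nat_compose_ln fps_ln_deriv) simp
  also have "\<dots> = log_quot ^ K * (1 + fps_X) ^ N
      * ((log_quot * ?i) ^ Suc m * ((1 + fps_X) * inverse (1 + fps_X)))"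
    by (simp only: power_add power_Suc power_one_right power_mult_distrib mult_ac Suc_eq_plus1 [symmetric])
  also have "\<dots> = log_quot ^ K * (1 + fps_X) ^ N" unfolding i x by simp
  finally show ?thesis
    using fps_nth_change_of_variable [OF log_quot_0, of "?E ^ (K + m + 1) * fps_exp (of_nat (Suc N))" m]
    unfolding fps_ln_eq_log_quot [symmetric] by simp
qed

text \<open>This is (x - 1)(x - 2)...(x - r), that is, r! times the binomial coefficient of x - 1
  over r, as it occurs in the expansion of (1 + y)^(x-1).\<close>

definition shifted_ff :: "nat \<Rightarrow> rat poly" where
  "shifted_ff r = (\<Prod>i<r. [:- of_nat (Suc i), 1:])"

lemma poly_shifted_ff: "poly (shifted_ff r) (of_nat (Suc N)) = fact r * of_nat (N choose r)"
  by (simp add: shifted_ff_def poly_prod binomial_gbinomial gbinomial_prod_rev atLeast0LessThan)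

lemma shifted_ff_Suc: "shifted_ff (Suc r) = [:- of_nat (Suc r), 1:] * shifted_ff r"
  by (simp add: shifted_ff_def)

lemma degree_shifted_ff: "degree (shifted_ff r) = r"
  unfolding shifted_ff_def by (subst degree_prod_eq_sum_degree) auto

lemma coeff_shifted_ff_same: "coeff (shifted_ff r) r = 1"
proof -
  have "lead_coeff (shifted_ff r) = 1" by (simp add: shifted_ff_def lead_coeff_prod)
  then show ?thesis by (simp add: degree_shifted_ff)
qed

lemma nu2_ge_coeff_shifted_ff: "nu2_ge 0 (coeff (shifted_ff r) i)"
proof (induction r arbitrary: i)
  case 0
  then show ?case using nu2_ge_of_nat [of 1] by (cases i) (auto simp: shifted_ff_def)
next
  case (Suc r)
  have "coeff (shifted_ff (Suc r)) i = coeff (pCons 0 (shifted_ff r)) i - of_nat (Suc r) * coeff (shifted_ff r) i"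
    unfolding shifted_ff_Suc by (simp add: algebra_simps)
  moreover have "nu2_ge 0 (coeff (pCons 0 (shifted_ff r)) i)"
    using Suc by (cases i) auto
  ultimately show ?case
    by (simp only: nu2_ge_diff nu2_ge_mult_of_nat [OF Suc])
qed

text \<open>Both polynomials agree at every positive integer, where (1 + y)^N is a finite binomial
  sum; hence their difference has infinitely many roots.\<close>

lemma higher_bernpoly_eq_sum:
  "higher_bernpoly (int (K + m + 1)) m
    = (\<Sum>r\<le>m. smult (fact m / fact r * (log_quot ^ K) $ (m - r)) (shifted_ff r))" (is "?B = ?S")
proof (rule ccontr)
  assume "?B \<noteq> ?S"
  then have "finite {x. poly (?B - ?S) x = 0}" by (intro poly_roots_finite) simp
  moreover have "range (\<lambda>N. of_nat (Suc N)) \<subseteq> {x. poly (?B - ?S) x = 0}"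
  proof safe
    fix N
    have "poly ?B (of_nat (Suc N)) = fact m * (log_quot ^ K * (1 + fps_X) ^ N) $ m"
      unfolding poly_higher_bernpoly power_int_of_nat bernoulli_fps_power_mult_exp_nth ..
    also have "\<dots> = fact m * (\<Sum>r\<le>m. (log_quot ^ K) $ (m - r) * of_nat (N choose r))"
      unfolding mult.commute [of "log_quot ^ K"] fps_mult_nth fps_binomial_of_nat [symmetric]
      by (simp add: fps_binomial_def binomial_gbinomial atLeast0AtMost mult.commute)
    also have "\<dots> = poly ?S (of_nat (Suc N))"
      unfolding poly_sum poly_smult poly_shifted_ff sum_distrib_left
      by (rule sum.cong) simp_all
    finally show "poly (?B - ?S) (of_nat (Suc N)) = 0" by simp
  qed
  moreover have "infinite (range (\<lambda>N. of_nat (Suc N) :: rat))"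
    by (rule range_inj_infinite) (auto simp: inj_def)
  ultimately show False using finite_subset by blast
qed

lemma coeff_sum_shifted_ff:
  "coeff (\<Sum>r\<le>m. smult (a r) (shifted_ff r)) m = a m"
proof -
  have "coeff (\<Sum>r\<le>m. smult (a r) (shifted_ff r)) m = (\<Sum>r\<le>m. if r = m then a r else 0)"
    unfolding coeff_sum
    by (rule sum.cong) (auto simp: coeff_shifted_ff_same degree_shifted_ff coeff_eq_0)
  then show ?thesis by simp
qed

text \<open>The transition between the monomials and the polynomials \<^term>\<open>shifted_ff r\<close> is integral and
  unitriangular, so both families of coefficients have the same poles.\<close>

lemma nu2_ge_shifted_ff_coeff:
  assumes "\<And>i. nu2_ge c (coeff (\<Sum>r\<le>m. smult (a r) (shifted_ff r)) i)" and "r \<le> m"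
  shows "nu2_ge c (a r)"
  using assms
proof (induction m)
  case 0
  from 0(1) [of 0] have "nu2_ge c (a 0)" unfolding coeff_sum_shifted_ff .
  with 0(2) show ?case by simp
next
  case (Suc m)
  have top: "nu2_ge c (a (Suc m))"
    using Suc.prems(1) [of "Suc m"] unfolding coeff_sum_shifted_ff .
  have "nu2_ge c (coeff (\<Sum>r\<le>m. smult (a r) (shifted_ff r)) i)" for i
  proof -
    have "coeff (\<Sum>r\<le>m. smult (a r) (shifted_ff r)) i
        = coeff (\<Sum>r\<le>Suc m. smult (a r) (shifted_ff r)) i - a (Suc m) * coeff (shifted_ff (Suc m)) i"
      by simp
    moreover have "nu2_ge c (a (Suc m) * coeff (shifted_ff (Suc m)) i)"
      using nu2_ge_mult [OF top nu2_ge_coeff_shifted_ff] by simp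
    ultimately show ?thesis by (simp only: nu2_ge_diff Suc.prems(1))
  qed
  then show ?case using Suc.IH top Suc.prems(2) by (cases "r = Suc m") auto
qed

text \<open>The definite description in \<open>max_pole\<close> denotes because the minimum is
  finite: the leading coefficient has finite valuation, and \<open>Minf\<close> never
  occurs.\<close>

lemma nu2_ge_max_pole:
  assumes "q \<noteq> 0"
  shows "nu2_ge (- max_pole q) (coeff q i)"
proof -
  let ?A = "nu2 ` set (coeffs q)"
  have fin: "finite ?A" by simp
  have mem: "lead_coeff q \<in> set (coeffs q)"
    using assms by (simp add: last_coeffs_eq_coeff_degree [symmetric])
  then have "Min ?A \<in> ?A" by (intro Min_in) auto
  then have "Min ?A \<noteq> Minf" using nu2_neq_Minf by (metis imageE)
  moreover have "Min ?A \<noteq> Pinf"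
  proof
    assume "Min ?A = Pinf"
    then have "nu2 (lead_coeff q) = Pinf"
      using Min_le [OF fin, of "nu2 (lead_coeff q)"] mem by auto
    moreover from assms have "lead_coeff q \<noteq> 0" by simp
    then obtain v where "nu2 (lead_coeff q) = Fin v" by (rule nu2_eq_Fin_obtain)
    ultimately show False by simp
  qed
  ultimately obtain v where v: "Min ?A = Fin v" by (cases "Min ?A") auto
  have "max_pole q = - v"
    unfolding max_pole_def v by (rule the_equality) auto
  then show ?thesis
  proof (cases "coeff q i = 0")
    case False
    then have "coeff q i \<in> set (coeffs q)"
      using range_coeff [of q] by (metis insertE rangeI)
    then show ?thesis
      using Min_le [OF fin, of "nu2 (coeff q i)"] v \<open>max_pole q = - v\<close> by (simp add: nu2_ge_iff)
  qed simp
qed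

text \<open>The bound concerns the coefficient of \<open>shifted_ff (d - j)\<close>. By Legendre's
  formula, its factor \<open>fact d / fact (d - j)\<close> and the scaling \<open>2 ^ j\<close> turn
  the pole into the stated digit sum expression.\<close>

lemma nu2_ge_log_coeff_max_pole:
  assumes "j \<le> d"
  shows "nu2_ge (int (sigma2 d) - max_pole (higher_bernpoly (int (K + d + 1)) d) - int (sigma2 (d - j)))
    (log_coeff K j)"
proof -
  let ?B = "higher_bernpoly (int (K + d + 1)) d"
  let ?a = "\<lambda>r. fact d / fact r * (log_quot ^ K) $ (d - r)"
  have "coeff ?B d = 1"
    unfolding higher_bernpoly_eq_sum coeff_sum_shifted_ff by (simp add: fps_power_zeroth log_quot_0)
  then have "?B \<noteq> 0" by auto
  from nu2_ge_max_pole [OF this] have "nu2_ge (- max_pole ?B) (?a (d - j))"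
    unfolding higher_bernpoly_eq_sum by (rule nu2_ge_shifted_ff_coeff) simp
  then have "nu2_ge (int j + - max_pole ?B) (2 ^ j * ?a (d - j))"
    by (rule nu2_ge_mult [OF nu2_ge_two_power])
  moreover have "2 ^ j * ?a (d - j) = fact d / fact (d - j) * log_coeff K j"
    using assms by (simp add: log_coeff_def)
  moreover have "int j + - max_pole ?B = (int d - int (sigma2 d) - (int (d - j) - int (sigma2 (d - j))))
      + (int (sigma2 d) - max_pole ?B - int (sigma2 (d - j)))"
    using assms by simp
  ultimately show ?thesis
    by (simp only: nu2_ge_mult_iff [OF nu2_fact_quotient])
qed

text \<open>Supplies the hypothesis of all the congruences, with \<open>\<mu>\<close> equal to
  \<open>sigma2 d\<close> minus the maximum pole.\<close>

lemma nu2_ge_binomial_max_pole: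
  assumes "j \<le> d"
  shows "nu2_ge (int (sigma2 d) - max_pole (higher_bernpoly (int (K + d + 1)) d) - int (sigma2 (d - j)))
    (of_nat (K choose j))"
  using nu2_ge_log_coeff_max_pole assms by (rule nu2_ge_binomial_if_log_coeff)

section \<open>Characterization of the zero cases\<close>

text \<open>Modulo \<open>2 ^ (\<mu> + 1)\<close> each summand is 0 or an odd multiple of
  \<open>2 ^ \<mu>\<close>, and two odd multiples cancel.\<close>

lemma nu2_ge_plus_one_add_iff:
  assumes "nu2_ge \<mu> x" and "nu2_ge \<mu> y"
  shows "nu2_ge (\<mu> + 1) (x + y) \<longleftrightarrow> (nu2_ge (\<mu> + 1) x \<longleftrightarrow> nu2_ge (\<mu> + 1) y)"
proof (cases "nu2_ge (\<mu> + 1) x \<or> nu2_ge (\<mu> + 1) y")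
  case True
  then show ?thesis
    using nu2_ge_cong [of "\<mu> + 1" "x + y" x] nu2_ge_cong [of "\<mu> + 1" "x + y" y] by auto
next
  case False
  with assms have v: "nu2 x = Fin \<mu>" "nu2 y = Fin \<mu>" by (simp_all add: nu2_eq_Fin_iff)
  from v have nz: "x \<noteq> 0" "y \<noteq> 0" by auto
  obtain m and a b :: int
    where x: "odd a" "odd b" "x = 2 powi m * (of_int a / of_int b)" "nu2 x = Fin m"
    using nz(1) by (rule nu2_eq_Fin_obtain)
  obtain l and c d :: int
    where y: "odd c" "odd d" "y = 2 powi l * (of_int c / of_int d)" "nu2 y = Fin l"
    using nz(2) by (rule nu2_eq_Fin_obtain)
  have ml: "m = \<mu>" "l = \<mu>" using v x(4) y(4) by simp_all
  have "even (a * d + c * b)" using x(1,2) y(1,2) by simp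
  then obtain e where e: "a * d + c * b = 2 * e" by (rule evenE)
  have "x + y = 2 powi \<mu> * (of_int (a * d + c * b) / of_int (b * d))"
    unfolding x(3) y(3) ml using odd_of_int_neq_0 [OF x(2)] odd_of_int_neq_0 [OF y(2)]
    by (simp add: add_frac_eq flip: distrib_left times_divide_eq_right)
  also have "\<dots> = 2 powi (\<mu> + 1) * (of_int e / of_int (b * d))"
    unfolding e by (simp add: power_int_add)
  finally have "nu2_ge (\<mu> + 1) (x + y)"
    using x(2) y(2) by (intro nu2_geI [of "b * d" _ _ e]) simp_all
  with False show ?thesis by simp
qed

lemma nu2_eq_Fin_cong:
  assumes "nu2_ge (\<mu> + 1) (x - y)" and "nu2_ge \<mu> y"
  shows "nu2 x = Fin \<mu> \<longleftrightarrow> \<not> nu2_ge (\<mu> + 1) y"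
proof -
  have "nu2_ge \<mu> (x - y)" using assms(1) by (rule nu2_ge_mono) simp
  then show ?thesis
    unfolding nu2_eq_Fin_iff using nu2_ge_cong [OF assms(1)] nu2_ge_cong [of \<mu> x y] assms(2) by blast
qed

lemma exactly_one_two: "exactly_one [a, b] \<longleftrightarrow> a \<noteq> b"
proof -
  have "i < length [a, b] \<and> [a, b] ! i \<longleftrightarrow> i = 0 \<and> a \<or> i = 1 \<and> b" for i
    by (auto simp: less_Suc_eq)
  moreover have "(0 :: nat) \<noteq> 1" by simp
  ultimately show ?thesis
    unfolding exactly_one_def by (cases a; cases b) (simp_all only: simp_thms, blast+)
qed

text \<open>Congruences only detect whether an odd number of alternatives holds; this differs from
  exactly one in the case that all three hold.\<close>

lemma exactly_one_three: "exactly_one [a, b, c] \<longleftrightarrow> (a \<noteq> b) \<noteq> c \<and> \<not> (a \<and> b \<and> c)"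
proof -
  have *: "i < length [a, b, c] \<and> [a, b, c] ! i \<longleftrightarrow> i = 0 \<and> a \<or> i = 1 \<and> b \<or> i = 2 \<and> c" for i
    by (auto simp: less_Suc_eq numeral_2_eq_2)
  have "(0 :: nat) \<noteq> 1" "(0 :: nat) \<noteq> 2" "(1 :: nat) \<noteq> 2" by simp_all
  then show ?thesis
    unfolding exactly_one_def * by (cases a; cases b; cases c) (simp_all only: simp_thms, blast+)
qed

lemma Fin_add_eq_Fin_iff: "Fin a + x = Fin b \<longleftrightarrow> x = Fin (b - a)" for a b :: int
  by (cases x) auto

section \<open>Counting the summands of minimal valuation\<close>

context
  fixes \<mu> :: int and K d :: nat
  assumes bound: "\<And>j. j \<le> d \<Longrightarrow> nu2_ge (\<mu> - int (sigma2 (d - j))) (of_nat (K choose j))"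
begin

lemma nu2_ge_binom_0: "nu2_ge \<mu> (of_nat (binom K (int d)))"
  using nu2_ge_binom [OF bound, of 0] by simp

lemma nu2_ge_binom_1: "nu2_ge \<mu> (2 * of_nat (binom K (int d - 1)))"
  using nu2_ge_binom [OF bound, of 1] by (simp add: nu2_ge_two_mult_iff)

lemma nu2_ge_binom_2: "nu2_ge \<mu> (2 * (of_nat d * of_nat (binom K (int d - 2))))"
  using nu2_ge_mult_of_nat [OF nu2_ge_binom [OF bound, of 2]] by (simp add: nu2_ge_two_mult_iff)

lemma nu2_binom_0_iff:
  "\<not> nu2_ge (\<mu> + 1) (of_nat (binom K (int d))) \<longleftrightarrow> nu2 (of_nat (binom K (int d))) = Fin \<mu>"
  using nu2_ge_binom_0 by (simp add: nu2_eq_Fin_iff)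

lemma nu2_binom_1_iff:
  "\<not> nu2_ge (\<mu> + 1) (2 * of_nat (binom K (int d - 1)))
    \<longleftrightarrow> nu2 (of_nat (binom K (int d - 1))) = Fin (\<mu> - 1)"
  using nu2_ge_binom_1 by (simp add: nu2_eq_Fin_iff nu2_ge_two_mult_iff)

text \<open>An even \<open>d\<close> contributes a further factor 2 and makes the summand vanish
  modulo \<open>2 ^ (\<mu> + 1)\<close>, whence the parity condition.\<close>

lemma nu2_binom_2_iff:
  "\<not> nu2_ge (\<mu> + 1) (2 * (of_nat d * of_nat (binom K (int d - 2))))
    \<longleftrightarrow> odd d \<and> nu2 (of_nat (binom K (int d - 2))) = Fin (\<mu> - 1)"
proof -
  let ?b = "of_nat (binom K (int d - 2)) :: rat"
  have b: "nu2_ge (\<mu> - 1) ?b" using nu2_ge_binom [OF bound, of 2] by simp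
  show ?thesis
  proof (cases "odd d")
    case True
    then show ?thesis
      using b nu2_ge_odd_mult_iff [of "int d" \<mu> ?b] by (simp add: nu2_eq_Fin_iff nu2_ge_two_mult_iff)
  next
    case False
    then have "nu2_ge 1 (of_nat d)" using nu2_ge_1_of_int_iff [of "int d"] by simp
    from nu2_ge_mult [OF this b] False show ?thesis by (simp add: nu2_ge_two_mult_iff)
  qed
qed

lemma nu2_log_coeff_eq_iff:
  "nu2 (log_coeff K d) = Fin \<mu> \<longleftrightarrow> exactly_one
    [nu2 (of_nat (binom K (int d))) = Fin \<mu>,
     odd d \<and> nu2 (of_nat (binom K (int d - 2))) = Fin (\<mu> - 1)]"
proof -
  have "nu2 (log_coeff K d) = Fin \<mu> \<longleftrightarrow> nu2 ((- 1) ^ d * log_coeff K d) = Fin \<mu>" by simp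
  also have "\<dots> \<longleftrightarrow> \<not> nu2_ge (\<mu> + 1)
      (of_nat (binom K (int d)) + 2 * (of_nat d * of_nat (binom K (int d - 2))))"
    by (intro nu2_eq_Fin_cong log_coeff_cong_binom [OF bound] nu2_ge_add nu2_ge_binom_0 nu2_ge_binom_2)
  also have "\<dots> \<longleftrightarrow> exactly_one
    [nu2 (of_nat (binom K (int d))) = Fin \<mu>,
     odd d \<and> nu2 (of_nat (binom K (int d - 2))) = Fin (\<mu> - 1)]"
    unfolding nu2_ge_plus_one_add_iff [OF nu2_ge_binom_0 nu2_ge_binom_2] exactly_one_two
    using nu2_binom_0_iff nu2_binom_2_iff by blast
  finally show ?thesis .
qed

text \<open>Let \<open>d = e + 2\<close>, so that \<open>e + 1\<close> is even. The relation between
  the indices \<open>e\<close> and \<open>e + 1\<close> forces \<open>K - e\<close> to be even; then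
  \<open>K - e - 1\<close> is odd, and the relation between \<open>e + 1\<close> and
  \<open>e + 2\<close> raises the middle valuation to \<open>\<mu>\<close>, a contradiction.\<close>

lemma not_all_binom_valuations:
  "\<not> (nu2 (of_nat (binom K (int d))) = Fin \<mu> \<and> nu2 (of_nat (binom K (int d - 1))) = Fin (\<mu> - 1) \<and>
    odd d \<and> nu2 (of_nat (binom K (int d - 2))) = Fin (\<mu> - 1))"
proof safe
  assume v: "nu2 (of_nat (binom K (int d))) = Fin \<mu>" "nu2 (of_nat (binom K (int d - 1))) = Fin (\<mu> - 1)"
      "nu2 (of_nat (binom K (int d - 2))) = Fin (\<mu> - 1)" and "odd d"
  \<comment> \<open>For smaller \<open>d\<close> the lower index is negative and the coefficient 0
    has infinite valuation.\<close>
  have "2 \<le> d" using v(3) by (cases "2 \<le> d") (auto simp: binom_def)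
  then obtain e where e: "d = Suc (Suc e)" by (metis add_2_eq_Suc le_iff_add)
  have "binom K (int d) = K choose Suc (Suc e)" "binom K (int d - 1) = K choose Suc e"
    "binom K (int d - 2) = K choose e"
    by (simp_all add: e binom_def nat_add_distrib)
  note v' = v [unfolded this]
  have v0: "nu2_ge \<mu> (of_nat (K choose Suc (Suc e)))"
    using v'(1) by (simp only: nu2_eq_Fin_iff)
  have v1: "nu2_ge (\<mu> - 1) (of_nat (K choose Suc e))" "\<not> nu2_ge \<mu> (of_nat (K choose Suc e))"
    using v'(2) unfolding nu2_eq_Fin_iff diff_add_cancel by blast+
  have v2: "\<not> nu2_ge \<mu> (of_nat (K choose e))"
    using v'(3) unfolding nu2_eq_Fin_iff diff_add_cancel by blast
  have le: "Suc (Suc e) \<le> K" using v'(1) by (cases "Suc (Suc e) \<le> K") (simp_all add: binomial_eq_0)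
  have "nu2_ge 1 (of_int (int (Suc e)))"
    using \<open>odd d\<close> e by (subst nu2_ge_1_of_int_iff) simp
  from nu2_ge_mult [OF this v1(1)]
  have "nu2_ge (1 + (\<mu> - 1)) (of_nat (Suc e * (K choose Suc e)))"
    unfolding of_nat_mult of_int_of_nat_eq .
  then have "nu2_ge \<mu> (of_nat (Suc e * (K choose Suc e)))" by (rule nu2_ge_mono) simp
  then have *: "nu2_ge \<mu> (of_int (int (K - e)) * of_nat (K choose e))"
    unfolding Suc_mult_binomial_Suc of_nat_mult of_int_of_nat_eq .
  have "even (K - e)"
    using * v2 nu2_ge_odd_mult_iff [of "int (K - e)" \<mu> "of_nat (K choose e)"]
    unfolding even_of_nat_iff by blast
  then have "odd (int (K - Suc e))" using le by (simp add: Suc_diff_Suc)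
  moreover have "nu2_ge \<mu> (of_nat (Suc (Suc e) * (K choose Suc (Suc e))))"
    unfolding of_nat_mult by (rule nu2_ge_mult_of_nat) fact
  then have "nu2_ge \<mu> (of_int (int (K - Suc e)) * of_nat (K choose Suc e))"
    unfolding Suc_mult_binomial_Suc of_nat_mult of_int_of_nat_eq .
  ultimately show False
    using v1(2) nu2_ge_odd_mult_iff [of "int (K - Suc e)" \<mu> "of_nat (K choose Suc e)"] by blast
qed

lemma nu2_log_coeff_shift_eq_iff:
  "nu2 (log_coeff_shift K d) = Fin \<mu> \<longleftrightarrow> exactly_one
    [nu2 (of_nat (binom K (int d))) = Fin \<mu>,
     nu2 (of_nat (binom K (int d - 1))) = Fin (\<mu> - 1),
     odd d \<and> nu2 (of_nat (binom K (int d - 2))) = Fin (\<mu> - 1)]"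
proof -
  note b01 = nu2_ge_add [OF nu2_ge_binom_0 nu2_ge_binom_1]
  have "nu2 (log_coeff_shift K d) = Fin \<mu> \<longleftrightarrow> nu2 ((- 1) ^ d * log_coeff_shift K d) = Fin \<mu>" by simp
  also have "\<dots> \<longleftrightarrow> \<not> nu2_ge (\<mu> + 1)
      (of_nat (binom K (int d)) + 2 * of_nat (binom K (int d - 1)) +
        2 * (of_nat d * of_nat (binom K (int d - 2))))"
    by (intro nu2_eq_Fin_cong log_coeff_shift_cong_binom [OF bound] nu2_ge_add [OF b01 nu2_ge_binom_2])
  also have "\<dots> \<longleftrightarrow> exactly_one
    [nu2 (of_nat (binom K (int d))) = Fin \<mu>,
     nu2 (of_nat (binom K (int d - 1))) = Fin (\<mu> - 1),
     odd d \<and> nu2 (of_nat (binom K (int d - 2))) = Fin (\<mu> - 1)]"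
    unfolding nu2_ge_plus_one_add_iff [OF b01 nu2_ge_binom_2]
      nu2_ge_plus_one_add_iff [OF nu2_ge_binom_0 nu2_ge_binom_1] exactly_one_three
    using nu2_binom_0_iff nu2_binom_1_iff nu2_binom_2_iff not_all_binom_valuations by blast
  finally show ?thesis .
qed

end

section \<open>The minimum zero cases, as the instance \<open>\<mu> = 0\<close>\<close>

lemma nu2_ge_binomial_0: "nu2_ge (0 - int (sigma2 i)) (of_nat (K choose j))"
  by (rule nu2_ge_mono [OF nu2_ge_of_nat]) simp

text \<open>Eliminates the alternatives with valuation \<open>\<mu> - 1\<close> when
  \<open>\<mu> = 0\<close>, leaving only the parity of one binomial coefficient.\<close>

lemma nu2_of_nat_neq_negative: "nu2 (of_nat a) \<noteq> Fin (0 - 1)"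
  unfolding nu2_eq_Fin_iff by simp

lemma nu2_log_coeff_eq_0_iff: "nu2 (log_coeff K d) = Fin 0 \<longleftrightarrow> odd (binom K (int d))"
  unfolding nu2_log_coeff_eq_iff [OF nu2_ge_binomial_0] exactly_one_two nu2_of_nat_eq_0_iff
  using nu2_of_nat_neq_negative by simp

lemma nu2_log_coeff_shift_eq_0_iff: "nu2 (log_coeff_shift K d) = Fin 0 \<longleftrightarrow> odd (binom K (int d))"
  unfolding nu2_log_coeff_shift_eq_iff [OF nu2_ge_binomial_0] exactly_one_three nu2_of_nat_eq_0_iff
  using nu2_of_nat_neq_negative by simp

lemma MZC_iff: "MZC (Suc K + d) (Suc K) \<longleftrightarrow> odd (binom K (int d))"
  unfolding MZC_def nu2_stirling_Suc Fin_add_eq_Fin_iff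
  by (simp add: nu2_log_coeff_shift_eq_0_iff)

lemma SMZC_iff: "SMZC (k + d) k \<longleftrightarrow> odd (binom k (int d))"
  unfolding SMZC_def nu2_stirling Fin_add_eq_Fin_iff
  by (simp add: nu2_log_coeff_eq_0_iff)

text \<open>The digit sums of \<open>K\<close> and \<open>K + d\<close> occur both in the valuation
  of the Stirling number and in that of the binomial coefficient, and cancel. The order n equals
  \<open>K + d + 1\<close>.\<close>

lemma AMZC_iff:
  "AMZC (Suc K + d) (Suc K) \<longleftrightarrow> nu2 (log_coeff_shift K d)
    = Fin (int (sigma2 d) - max_pole (higher_bernpoly (int (K + d + 1)) d))"
proof -
  have "nu2 (of_nat ((Suc K + d - 1) choose (Suc K - 1)))
      = Fin (int (sigma2 K) + int (sigma2 d) - int (sigma2 (K + d)))"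
    using nu2_binomial [of K "K + d"] by simp
  moreover have "int (Suc K + d) = int (K + d + 1)" "Suc K + d - Suc K = d" by simp_all
  ultimately show ?thesis
    unfolding AMZC_def nu2_stirling_Suc by (simp only: minus_extended_simps Fin_add_eq_Fin_iff) simp
qed

lemma SAMZC_iff:
  "SAMZC (k + d) k \<longleftrightarrow> nu2 (log_coeff k d)
    = Fin (int (sigma2 d) - max_pole (higher_bernpoly (int (k + d + 1)) d))"
proof -
  have "nu2 (of_nat ((k + d) choose k))
      = Fin (int (sigma2 k) + int (sigma2 d) - int (sigma2 (k + d)))"
    using nu2_binomial [of k "k + d"] by simp
  moreover have "int (k + d) + 1 = int (k + d + 1)" "k + d - k = d" by simp_all
  ultimately show ?thesis
    unfolding SAMZC_def nu2_stirling by (simp only: minus_extended_simps Fin_add_eq_Fin_iff) simp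
qed

text \<open>Let \<open>v\<close> be the valuation of \<open>k + d + 1\<close>. As a difference,
  \<open>d\<close> is divisible by \<open>2 ^ v\<close>, so
  \<open>k - d + 1 = (k + d + 1) - 2 * d\<close> has valuation exactly \<open>v\<close>. Cancelling
  it in the relation between the binomial coefficients with lower indices \<open>d - 1\<close> and
  \<open>d\<close> preserves the bound.\<close>

lemma nu2_ge_binom_pred:
  assumes "nu2 (of_nat (k + d + 1)) \<le> nu2 (of_nat (k + 1))"
    and "nu2_ge \<mu> (of_nat (k choose d))"
  shows "nu2_ge \<mu> (of_nat (binom k (int d - 1)))"
proof (cases "1 \<le> d \<and> d \<le> Suc k")
  case False
  then show ?thesis by (auto simp: binom_def binomial_eq_0)
next
  case True
  then obtain e where d: "d = Suc e" and e: "e \<le> k" by (cases d) auto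
  obtain v where v: "nu2 (of_nat (k + d + 1)) = Fin v"
    using nu2_of_nat_Suc [of "k + d"] by simp
  then have n: "nu2_ge v (of_nat (k + d + 1))" "\<not> nu2_ge (v + 1) (of_nat (k + d + 1))"
    unfolding nu2_eq_Fin_iff by simp_all
  have "nu2_ge v (of_nat (k + 1))" using assms(1) v by (simp add: nu2_ge_iff)
  from nu2_ge_diff [OF n(1) this] have d': "nu2_ge v (of_nat d)" by simp
  then have 2: "nu2_ge (v + 1) (2 * of_nat d)" by (simp add: nu2_ge_two_mult_iff)
  then have twice: "nu2_ge v (2 * of_nat d)" by (rule nu2_ge_mono) simp
  have eq: "of_nat (k + d + 1) - of_nat (k - e) = (2 * of_nat d :: rat)"
    using e by (simp add: d of_nat_diff)
  have "nu2 (of_nat (k - e)) = Fin v"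
    unfolding nu2_eq_Fin_iff
    using nu2_ge_cong [of v "of_nat (k + d + 1)" "of_nat (k - e)"]
      nu2_ge_cong [of "v + 1" "of_nat (k + d + 1)" "of_nat (k - e)"] n 2 twice
    unfolding eq by blast
  moreover have "nu2_ge (v + \<mu>) (of_nat (k - e) * of_nat (k choose e))"
    using nu2_ge_mult [OF d' assms(2)]
    unfolding d of_nat_mult [symmetric] Suc_mult_binomial_Suc .
  ultimately have "nu2_ge \<mu> (of_nat (k choose e))"
    by (simp only: nu2_ge_mult_iff)
  moreover have "binom k (int d - 1) = k choose e" by (simp add: d binom_def)
  ultimately show ?thesis by simp
qed

text \<open>Both sides refer to the same Bernoulli polynomial. The hypothesis excludes the middle
  alternative of the three, after which the two lists agree.\<close>

lemma SAMZC_iff_AMZC_Suc: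
  assumes "nu2 (of_nat (k + d + 1)) \<le> nu2 (of_nat (k + 1))"
  shows "SAMZC (k + d) k \<longleftrightarrow> AMZC (Suc k + d) (Suc k)"
proof -
  let ?\<mu> = "int (sigma2 d) - max_pole (higher_bernpoly (int (k + d + 1)) d)"
  have "nu2_ge ?\<mu> (of_nat (binom k (int d - 1)))"
    using assms nu2_ge_binomial_max_pole [of d d k] by (intro nu2_ge_binom_pred) simp_all
  then have "nu2 (of_nat (binom k (int d - 1))) \<noteq> Fin (?\<mu> - 1)"
    unfolding nu2_eq_Fin_iff by simp
  moreover note nu2_log_coeff_eq_iff [OF nu2_ge_binomial_max_pole [of _ d k]]
    nu2_log_coeff_shift_eq_iff [OF nu2_ge_binomial_max_pole [of _ d k]]
  ultimately show ?thesis
    unfolding SAMZC_iff AMZC_iff exactly_one_two exactly_one_three by blast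
qed

theorem theorem4p6:
  fixes n k :: nat and M M' :: int
  assumes "1 \<le> k" and "k \<le> n"
    and "M = max_pole (higher_bernpoly (int n) (n - k))"
    and "M' = max_pole (higher_bernpoly (int n + 1) (n - k))"
  shows
    "(MZC n k \<longleftrightarrow> \<not> 2 dvd binom (k - 1) (int n - int k)) \<and>

     (SMZC n k \<longleftrightarrow> \<not> 2 dvd binom k (int n - int k)) \<and>
     (\<not> 2 dvd binom k (int n - int k) \<longleftrightarrow> MZC (n + 1) (k + 1)) \<and>

     (AMZC n k \<longleftrightarrow> exactly_one
       [nu2 (of_nat (binom (k - 1) (int n - int k))) = Fin (int (sigma2 (n - k)) - M),
        nu2 (of_nat (binom (k - 1) (int n - int k - 1))) = Fin (int (sigma2 (n - k)) - M - 1),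
        odd (n - k) \<and>
          nu2 (of_nat (binom (k - 1) (int n - int k - 2))) = Fin (int (sigma2 (n - k)) - M - 1)]) \<and>

     (SAMZC n k \<longleftrightarrow> exactly_one
       [nu2 (of_nat (binom k (int n - int k))) = Fin (int (sigma2 (n - k)) - M'),
        odd (n - k) \<and>
          nu2 (of_nat (binom k (int n - int k - 2))) = Fin (int (sigma2 (n - k)) - M' - 1)]) \<and>

     (nu2 (of_nat (n + 1)) \<le> nu2 (of_nat (k + 1)) \<longrightarrow>
       (SAMZC n k \<longleftrightarrow> AMZC (n + 1) (k + 1)) \<and>
       (SAMZC n k \<longrightarrow>
         nu2 (of_nat (stirling n k)) = nu2 (of_nat (stirling (n + 1) (k + 1)))))"
proof -
  define d K where "d = n - k" and "K = k - 1"
  have n: "n = k + d" and k: "k = Suc K" using assms(1,2) by (simp_all add: d_def K_def)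
  have ints: "int n - int k = int d" "n - k = d" "k - 1 = K" using n k by simp_all
  have Suc: "n + 1 = Suc k + d" "k + 1 = Suc k" using n by simp_all
  \<comment> \<open>Both poles fit the order \<open>K + d + 1\<close> with the same
    \<open>d\<close>: order n uses the exponent \<open>K = k - 1\<close>, order n + 1 uses
    \<open>k\<close>.\<close>
  have M: "M = max_pole (higher_bernpoly (int (K + d + 1)) d)"
    and M': "M' = max_pole (higher_bernpoly (int (k + d + 1)) d)"
    unfolding assms(3,4) ints n k by simp_all
  have "MZC n k \<longleftrightarrow> odd (binom K (int d))"
    using MZC_iff [of K d] n k by simp
  moreover have "SMZC n k \<longleftrightarrow> odd (binom k (int d))"
    using SMZC_iff [of k d] n by simp
  moreover have "odd (binom k (int d)) \<longleftrightarrow> MZC (n + 1) (k + 1)"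
    unfolding Suc MZC_iff ..
  moreover have "AMZC n k \<longleftrightarrow> nu2 (log_coeff_shift K d) = Fin (int (sigma2 d) - M)"
    unfolding M using AMZC_iff [of K d] n k by simp
  moreover have "SAMZC n k \<longleftrightarrow> nu2 (log_coeff k d) = Fin (int (sigma2 d) - M')"
    unfolding M' n by (rule SAMZC_iff)
  moreover have "(SAMZC n k \<longleftrightarrow> AMZC (n + 1) (k + 1)) \<and>
      (SAMZC n k \<longrightarrow> nu2 (of_nat (stirling n k)) = nu2 (of_nat (stirling (n + 1) (k + 1))))"
    if h: "nu2 (of_nat (n + 1)) \<le> nu2 (of_nat (k + 1))"
  proof -
    have iff: "SAMZC (k + d) k \<longleftrightarrow> AMZC (Suc k + d) (Suc k)"
      using h unfolding n by (rule SAMZC_iff_AMZC_Suc)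
    moreover have "nu2 (of_nat (stirling (k + d) k)) = nu2 (of_nat (stirling (Suc k + d) (Suc k)))"
      if "SAMZC (k + d) k"
    proof -
      \<comment> \<open>Both valuations equal \<open>sigma2 d\<close> minus the common pole, and the
        digit sum offsets to the two Stirling numbers coincide.\<close>
      from that have "nu2 (log_coeff k d) = nu2 (log_coeff_shift k d)"
        using iff unfolding SAMZC_iff AMZC_iff by simp
      then show ?thesis unfolding nu2_stirling_Suc nu2_stirling [of k] by simp
    qed
    ultimately show ?thesis unfolding Suc unfolding n by blast
  qed
  moreover note nu2_log_coeff_shift_eq_iff [OF nu2_ge_binomial_max_pole [of _ d K], folded M]
  moreover note nu2_log_coeff_eq_iff [OF nu2_ge_binomial_max_pole [of _ d k], folded M']
  ultimately show ?thesis unfolding ints by blast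
qed

end
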